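(* Let $\mu=\sum_{\lambda\in\Lambda}a_\lambda\delta_\lambda$ be a large Fourier quasicrystal on $\mathbb{R}^d$ such that the set of differences $\Lambda-\Lambda=\{\lambda-\lambda':\ \lambda,\lambda'\in\Lambda\}$ is discrete. Then $\Lambda$ is a finite union of translates of a single full-rank lattice $L\subset\mathbb{R}^d$.
   Context: Notation: $B(x,r)=\{y\in\mathbb{R}^d:|y-x|<r\}$, $B(r)=B(0,r)$; $\delta_z$ is the unit mass at $z$. A set $E\subset\mathbb{R}^d$ is discrete if $E\cap B(x,1)$ is finite for every $x\in\mathbb{R}^d$. A full-rank lattice is a set $T\mathbb{Z}^d$ with $T$ a nondegenerate linear operator on $\mathbb{R}^d$. Measures are complex Radon measures. A measure $\mu$ is slowly increasing if its variation satisfies: $|\mu|(B(r))$ grows at most polynomially as $r\to\infty$; such a measure is a tempered distribution. The Fourier transform of $f\in S'(\mathbb{R}^d)$ is defined by $\hat f(\varphi)=f(\hat\varphi)$ for $\varphi\in S(\mathbb{R}^d)$, where $\hat\varphi(y)=\int_{\mathbb{R}^d}\varphi(x)e^{-2\pi i\langle x,y\rangle}dx$. A measure $\mu$ is a Fourier quasicrystal if both $\mu$ and $\hat\mu$ are slowly increasing atomic measures, i.e. $\mu=\sum_{\lambda\in\Lambda}a_\lambda\delta_\lambda$, $\hat\mu=\sum_{\gamma\in\Gamma}b_\gamma\delta_\gamma$ with countable sets $\Lambda,\Gamma$, nonzero coefficients, and $\sum_{|\lambda|<r}|a_\lambda|+\sum_{|\gamma|<r}|b_\gamma|$ growing at most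 polynomially as $r\to\infty$. $\Lambda$ is called the support and $\Gamma$ the spectrum of $\mu$. The quasicrystal is large if in addition $\inf_{\lambda\in\Lambda}|a_\lambda|>0$. *)

theory Defs
  imports "HOL-Analysis.Analysis" "HOL-Library.Landau_Symbols" "HOL-Library.Extended_Real"
begin

subsection \<open>Schwartz functions and the Fourier transform\<close>

definition partial_deriv :: "'d::finite \<Rightarrow> (real^'d \<Rightarrow> complex) \<Rightarrow> (real^'d \<Rightarrow> complex)"
  where "partial_deriv i f = (\<lambda>x. frechet_derivative f (at x) (axis i 1))"

fun iter_partial_deriv :: "'d::finite list \<Rightarrow> (real^'d \<Rightarrow> complex) \<Rightarrow> (real^'d \<Rightarrow> complex)"
  where
    "iter_partial_deriv [] f = f"
  | "iter_partial_deriv (i # is) f = partial_deriv i (iter_partial_deriv is f)"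

text \<open>A function is smooth iff each of its iterated partial derivatives is Frechet
  differentiable at every point; then all of them are continuous.\<close>

definition smooth :: "(real^'d::finite \<Rightarrow> complex) \<Rightarrow> bool"
  where "smooth f \<longleftrightarrow> (\<forall>is x. iter_partial_deriv is f differentiable (at x))"

definition schwartz :: "(real^'d::finite \<Rightarrow> complex) \<Rightarrow> bool"
  where "schwartz f \<longleftrightarrow> smooth f \<and>
    (\<forall>is k. bounded (range (\<lambda>x. norm x ^ k * cmod (iter_partial_deriv is f x))))"

definition fourier :: "(real^'d::finite \<Rightarrow> complex) \<Rightarrow> (real^'d \<Rightarrow> complex)"
  where "fourier \<phi> = (\<lambda>y. LINT x|lborel.
    \<phi> x * exp (- 2 * of_real pi * \<i> * of_real (x \<bullet> y)))"

text \<open>Distributions are represented by functionals on all functions; only their values on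
  Schwartz functions matter.\<close>

type_synonym 'd distribution = "(real^'d \<Rightarrow> complex) \<Rightarrow> complex"

definition fourier_dist :: "('d::finite) distribution \<Rightarrow> 'd distribution"
  where "fourier_dist f = (\<lambda>\<phi>. f (fourier \<phi>))"

definition eq_dist :: "('d::finite) distribution \<Rightarrow> 'd distribution \<Rightarrow> bool"
  where "eq_dist f g \<longleftrightarrow> (\<forall>\<phi>. schwartz \<phi> \<longrightarrow> f \<phi> = g \<phi>)"


subsection \<open>Fourier quasicrystals\<close>

text \<open>An atomic complex measure is represented by a set \<open>\<Lambda>\<close> of atoms and a mass function
  \<open>a\<close>, whose values outside \<open>\<Lambda>\<close> are irrelevant. The variation of this measure gives the ball
  \<open>B(r)\<close> the mass \<open>\<Sum>x\<in>\<Lambda> \<inter> B(r). |a x|\<close>; it has to be finite for every \<open>r\<close> (the Radon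
  property). Summability is required explicitly because \<open>infsum\<close> is \<open>0\<close> on families that are not
  summable.\<close>

definition slowly_increasing_atomic ::
    "(real^'d::finite) set \<Rightarrow> (real^'d \<Rightarrow> complex) \<Rightarrow> bool"
  where "slowly_increasing_atomic \<Lambda> a \<longleftrightarrow>
    countable \<Lambda> \<and>
    (\<forall>x\<in>\<Lambda>. a x \<noteq> 0) \<and>
    (\<forall>r. (\<lambda>x. cmod (a x)) summable_on (\<Lambda> \<inter> ball 0 r)) \<and>
    (\<exists>n::nat. (\<lambda>r. \<Sum>\<^sub>\<infinity>x\<in>\<Lambda> \<inter> ball 0 r. cmod (a x)) \<in> O[at_top](\<lambda>r. r ^ n))"

text \<open>The distribution \<open>\<Sum>x\<in>\<Lambda>. a x * \<delta>\<^sub>x\<close>; for slowly increasing data the sum converges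
  absolutely on every Schwartz function.\<close>

definition delta_sum ::
    "(real^'d::finite) set \<Rightarrow> (real^'d \<Rightarrow> complex) \<Rightarrow> 'd distribution"
  where "delta_sum \<Lambda> a = (\<lambda>\<phi>. \<Sum>\<^sub>\<infinity>x\<in>\<Lambda>. a x * \<phi> x)"

definition fourier_quasicrystal ::
    "(real^'d::finite) set \<Rightarrow> (real^'d \<Rightarrow> complex) \<Rightarrow> bool"
  where "fourier_quasicrystal \<Lambda> a \<longleftrightarrow>
    slowly_increasing_atomic \<Lambda> a \<and>
    (\<exists>\<Gamma> b. slowly_increasing_atomic \<Gamma> b \<and>
      eq_dist (fourier_dist (delta_sum \<Lambda> a)) (delta_sum \<Gamma> b))"

text \<open>The infimum is taken in the extended reals, so that it is \<open>\<infinity>\<close> for the zero measure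
  (empty \<open>\<Lambda>\<close>).\<close>

definition large_fourier_quasicrystal ::
    "(real^'d::finite) set \<Rightarrow> (real^'d \<Rightarrow> complex) \<Rightarrow> bool"
  where "large_fourier_quasicrystal \<Lambda> a \<longleftrightarrow>
    fourier_quasicrystal \<Lambda> a \<and> (INF x\<in>\<Lambda>. ereal (cmod (a x))) > 0"


subsection \<open>Discrete sets and lattices\<close>

text \<open>This is local finiteness, which is stronger than \<open>discrete\<close> of \<open>HOL-Analysis\<close> (all points
  isolated).\<close>

definition discrete_set :: "(real^'d::finite) set \<Rightarrow> bool"
  where "discrete_set E \<longleftrightarrow> (\<forall>x. finite (E \<inter> ball x 1))"

definition difference_set :: "(real^'d::finite) set \<Rightarrow> (real^'d) set"
  where "difference_set E = {x - y | x y. x \<in> E \<and> y \<in> E}"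

definition full_rank_lattice :: "(real^'d::finite) set \<Rightarrow> bool"
  where "full_rank_lattice L \<longleftrightarrow>
    (\<exists>T :: real^'d \<Rightarrow> real^'d. linear T \<and> bij T \<and> L = T ` {x. \<forall>i. x $ i \<in> \<int>})"

end

theory Submission imports Defs "HOL-Probability.Characteristic_Functions"
begin

text \<open>
  Write \<open>c\<close> for the infimum of the \<open>|a\<^sub>\<lambda>|\<close> and average \<open>\<mu>\<close> against a Gaussian of width about \<open>1 / sqrt q\<close>:
  \<open>F(t) = \<Sum> a\<^sub>\<lambda> exp(-q |\<lambda> - t|\<^sup>2)\<close>. The Gaussian is, up to a constant, the Fourier transform of a
  modulated Gaussian, so testing the Fourier transform of \<open>\<mu>\<close> against that function writes \<open>F\<close> as an
  absolutely convergent sum of characters. Such a sum is uniformly almost periodic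
  (\<open>relatively_dense_almost_periods\<close>).

  Since \<open>\<Lambda> - \<Lambda>\<close> is locally finite, \<open>\<Lambda>\<close> is uniformly separated, and the masses turn out to be bounded
  (\<open>fourier_quasicrystal_bounded_masses\<close>). For large \<open>q\<close> the value \<open>F(\<lambda>)\<close> is then close to \<open>a\<^sub>\<lambda>\<close>, while
  \<open>F\<close> is uniformly small off an \<open>\<eta>\<close>-neighbourhood of \<open>\<Lambda>\<close>. As \<open>|a\<^sub>\<lambda>| \<ge> c\<close>, every sufficiently good
  almost period \<open>\<tau>\<close> of \<open>F\<close> moves each point of \<open>\<Lambda>\<close> to within \<open>\<eta>\<close> of a point of \<open>\<Lambda>\<close>, and so does
  \<open>-\<tau>\<close> (\<open>relatively_dense_almost_translates\<close>).

  Now almost translations improve to exact ones (\<open>relatively_dense_periods\<close>). If \<open>\<sigma>(\<lambda>)\<close> is the point of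
  \<open>\<Lambda>\<close> near \<open>\<lambda> + \<tau>\<close>, then for neighbours \<open>\<lambda>\<close>, \<open>\<lambda>'\<close> both \<open>\<sigma>(\<lambda>) - \<sigma>(\<lambda>')\<close> and \<open>\<lambda> - \<lambda>'\<close> lie in a fixed
  bounded, hence finite, part of \<open>\<Lambda> - \<Lambda>\<close> and differ by less than \<open>2 \<eta>\<close>; for small \<open>\<eta>\<close> they are equal.
  So the error \<open>\<sigma>(\<lambda>) - \<lambda> - \<tau>\<close> does not change from neighbour to neighbour. Moreover \<open>\<Lambda>\<close> is relatively
  dense, because its almost translations are and move a given point of \<open>\<Lambda>\<close> close to points of \<open>\<Lambda>\<close>. So any
  two of its points are joined by a chain of neighbours, the error is constant, and \<open>\<tau>\<close> plus this
  constant is a period of \<open>\<Lambda>\<close>.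

  Thus the periods of \<open>\<Lambda>\<close> are relatively dense. Periods close to large multiples of the coordinate
  vectors are linearly independent and generate a full-rank lattice of periods, modulo which
  \<open>\<Lambda>\<close> has only finitely many points (\<open>finite_union_of_lattice_translates\<close>).
\<close>

section \<open>Sets with locally finite differences\<close>

definition relatively_dense :: "'a::metric_space set \<Rightarrow> bool"
  where "relatively_dense T \<longleftrightarrow> (\<exists>R. \<forall>x. \<exists>\<tau>\<in>T. dist x \<tau> < R)"

lemma relatively_dense_mono: "relatively_dense S \<Longrightarrow> S \<subseteq> T \<Longrightarrow> relatively_dense T"
  unfolding relatively_dense_def by blast

lemma discrete_set_finite_cball:
  assumes "discrete_set E"
  shows "finite (E \<inter> cball x r)"
proof -
  obtain K where K: "finite K" "cball x r \<subseteq> (\<Union>y\<in>K. ball y 1)"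
    using compact_cball[of x r, unfolded compact_eq_totally_bounded] zero_less_one by blast
  have "E \<inter> cball x r \<subseteq> (\<Union>y\<in>K. E \<inter> ball y 1)"
    using K by blast
  moreover have "finite (\<Union>y\<in>K. E \<inter> ball y 1)"
    using K assms unfolding discrete_set_def by blast
  ultimately show ?thesis by (rule finite_subset)
qed

lemma difference_setI: "x \<in> E \<Longrightarrow> y \<in> E \<Longrightarrow> x - y \<in> difference_set E"
  by (auto simp: difference_set_def)

lemma finite_set_separated:
  fixes D :: "'a::metric_space set"
  assumes "finite D"
  obtains \<kappa> where "\<kappa> > 0" "\<And>u v. u \<in> D \<Longrightarrow> v \<in> D \<Longrightarrow> dist u v < \<kappa> \<Longrightarrow> u = v"
proof -
  have fin: "finite ((\<lambda>(u, v). dist u v) ` {p \<in> D \<times> D. fst p \<noteq> snd p})" (is "finite ?S")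
    using assms by auto
  define \<kappa> where "\<kappa> = Min (insert 1 ?S)"
  have "\<kappa> > 0"
    unfolding \<kappa>_def using fin by (subst Min_gr_iff) auto
  moreover have "u = v" if "u \<in> D" "v \<in> D" "dist u v < \<kappa>" for u v
  proof (rule ccontr)
    assume "u \<noteq> v"
    then have "dist u v \<in> insert 1 ?S" using that by force
    then have "\<kappa> \<le> dist u v" unfolding \<kappa>_def using fin by (intro Min_le) auto
    then show False using that by simp
  qed
  ultimately show ?thesis using that by blast
qed

lemma finite_Int_cball_of_difference_set:
  assumes "discrete_set (difference_set \<Lambda>)"
  shows "finite (\<Lambda> \<inter> cball x r)"
proof (cases "\<Lambda> = {}")
  case False
  then obtain l where l: "l \<in> \<Lambda>" by blast
  have "\<Lambda> \<inter> cball x r \<subseteq> (+) l ` (difference_set \<Lambda> \<inter> cball (x - l) r)"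
  proof
    fix y assume y: "y \<in> \<Lambda> \<inter> cball x r"
    then have "y - l \<in> difference_set \<Lambda> \<inter> cball (x - l) r"
      using l by (auto intro: difference_setI simp: dist_norm)
    then show "y \<in> (+) l ` (difference_set \<Lambda> \<inter> cball (x - l) r)" by force
  qed
  then show ?thesis
    using discrete_set_finite_cball[OF assms] by (metis finite_imageI finite_subset)
qed auto

lemma separated_of_discrete_differences:
  assumes "discrete_set (difference_set \<Lambda>)"
  shows "\<exists>g>0. \<forall>x\<in>\<Lambda>. \<forall>y\<in>\<Lambda>. x \<noteq> y \<longrightarrow> g \<le> dist x y"
proof -
  obtain \<kappa> where \<kappa>: "\<kappa> > 0" "\<And>u v. u \<in> difference_set \<Lambda> \<inter> cball 0 1 \<Longrightarrow>
        v \<in> difference_set \<Lambda> \<inter> cball 0 1 \<Longrightarrow> dist u v < \<kappa> \<Longrightarrow> u = v"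
    by (rule finite_set_separated[OF discrete_set_finite_cball[OF assms, of 0 1]]) blast
  have "min \<kappa> 1 \<le> dist x y" if xy: "x \<in> \<Lambda>" "y \<in> \<Lambda>" "x \<noteq> y" for x y
  proof (rule ccontr)
    assume "\<not> ?thesis"
    then have "norm (x - y) < \<kappa>" "norm (x - y) \<le> 1" by (auto simp: dist_norm)
    then have "x - y = 0"
      using difference_setI[OF xy(1,2)] difference_setI[OF xy(1,1)] by (intro \<kappa>(2)) auto
    then show False using xy by simp
  qed
  then show ?thesis using \<kappa>(1) by (intro exI[of _ "min \<kappa> 1"]) simp
qed

text \<open>Any two points of a relatively dense set are joined by a chain of short steps within the set: follow
  the segment between them in steps of length at most \<open>1\<close> and replace each point of the segment by a
  point of \<open>S\<close> near it.\<close>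

lemma constant_along_chains:
  fixes f :: "'a::euclidean_space \<Rightarrow> 'b"
  assumes dense: "\<And>x. \<exists>y\<in>S. dist x y < R"
    and step: "\<And>u v. u \<in> S \<Longrightarrow> v \<in> S \<Longrightarrow> dist u v \<le> 2 * R + 1 \<Longrightarrow> f u = f v"
    and "u \<in> S" "v \<in> S"
  shows "f u = f v"
proof -
  have R: "R > 0" using dense[of u] by (auto intro: le_less_trans[OF zero_le_dist])
  define N where "N = nat \<lceil>dist u v\<rceil> + 1"
  have N: "N > 0" "dist u v \<le> real N" unfolding N_def by linarith+
  define c where "c k = u + (real k / real N) *\<^sub>R (v - u)" for k
  obtain y where y: "\<And>x. y x \<in> S" "\<And>x. dist x (y x) < R"
    using dense by metis
  have "f (y (c k)) = f (y (c 0))" for k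
  proof (induction k)
    case (Suc k)
    have "c (Suc k) - c k = (1 / real N) *\<^sub>R (v - u)"
      unfolding c_def by (simp add: algebra_simps add_divide_distrib)
    then have "dist (c (Suc k)) (c k) = dist u v / real N"
      by (simp add: dist_norm norm_minus_commute)
    also have "\<dots> \<le> 1" using N by simp
    finally have "dist (y (c (Suc k))) (y (c k)) \<le> 2 * R + 1"
      using y(2)[of "c k"] y(2)[of "c (Suc k)"]
        dist_triangle[of "y (c (Suc k))" "y (c k)" "c (Suc k)"]
        dist_triangle[of "c (Suc k)" "y (c k)" "c k"]
      by (simp add: dist_commute)
    then show ?case using Suc y(1) step by metis
  qed simp
  from this[of N] have "f (y v) = f (y u)" using N by (simp add: c_def)
  moreover have "dist w (y w) \<le> 2 * R + 1" for w using y(2)[of w] R by linarith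
  then have "f u = f (y u)" "f v = f (y v)" using y(1) step assms(3,4) by blast+
  ultimately show ?thesis by simp
qed

definition periods :: "'a::ab_group_add set \<Rightarrow> 'a set"
  where "periods S = {p. (\<forall>x\<in>S. x + p \<in> S) \<and> (\<forall>x\<in>S. x - p \<in> S)}"

lemma periods_0: "0 \<in> periods S"
  by (simp add: periods_def)

lemma periods_uminus: "p \<in> periods S \<Longrightarrow> - p \<in> periods S"
  by (simp add: periods_def)

lemma periods_add: "p \<in> periods S \<Longrightarrow> q \<in> periods S \<Longrightarrow> p + q \<in> periods S"
  unfolding periods_def by (auto simp flip: add.assoc diff_diff_eq)

lemma periods_sum: "(\<And>i. i \<in> I \<Longrightarrow> f i \<in> periods S) \<Longrightarrow> sum f I \<in> periods S"
  by (induction I rule: infinite_finite_induct) (auto simp: periods_0 periods_add)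

lemma periods_scaleR_int:
  fixes p :: "'a::real_vector"
  assumes "p \<in> periods S" "c \<in> \<int>"
  shows "c *\<^sub>R p \<in> periods S"
proof -
  have nat: "real n *\<^sub>R p \<in> periods S" for n
    by (induction n) (auto simp: periods_0 periods_add assms scaleR_add_left)
  obtain k where k: "c = of_int k" using assms(2) by (auto elim: Ints_cases)
  show ?thesis
  proof (cases "k \<ge> 0")
    case True
    then show ?thesis using nat[of "nat k"] k by simp
  next
    case False
    then show ?thesis using periods_uminus[OF nat[of "nat (- k)"]] k by simp
  qed
qed

text \<open>Both \<open>\<tau>\<close> and \<open>-\<tau>\<close> are required, since an exact period has to map the set onto itself and not merely
  into itself.\<close>

definition almost_translates :: "'a::real_normed_vector set \<Rightarrow> real \<Rightarrow> 'a set"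
  where "almost_translates S \<eta> = {\<tau>.
    (\<forall>x\<in>S. \<exists>y\<in>S. norm (y - (x + \<tau>)) < \<eta>) \<and> (\<forall>x\<in>S. \<exists>y\<in>S. norm (y - (x - \<tau>)) < \<eta>)}"

text \<open>The rigidity step. The radius \<open>2 * R + 3\<close> allows for neighbours at distance \<open>2 * R + 1\<close> in a chain and
  for two errors of size at most \<open>1\<close>; within this radius, distinct differences are \<open>\<kappa>\<close> apart, so
  that errors below \<open>\<kappa> / 2\<close> cannot change along a chain.\<close>

lemma almost_translates_shift_constant:
  fixes \<Lambda> :: "(real^'d::finite) set"
  assumes dense: "\<And>x. \<exists>y\<in>\<Lambda>. dist x y < R"
    and \<kappa>: "\<And>u v. u \<in> difference_set \<Lambda> \<inter> cball 0 (2 * R + 3) \<Longrightarrow>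
        v \<in> difference_set \<Lambda> \<inter> cball 0 (2 * R + 3) \<Longrightarrow> dist u v < \<kappa> \<Longrightarrow> u = v"
    and \<eta>: "2 * \<eta> \<le> \<kappa>" "\<eta> \<le> 1"
    and \<tau>: "\<And>x. x \<in> \<Lambda> \<Longrightarrow> \<exists>y\<in>\<Lambda>. norm (y - (x + \<tau>)) < \<eta>"
  shows "\<exists>s. norm s < \<eta> \<and> (\<forall>x\<in>\<Lambda>. x + (\<tau> + s) \<in> \<Lambda>)"
proof -
  obtain \<sigma> where \<sigma>: "\<And>x. x \<in> \<Lambda> \<Longrightarrow> \<sigma> x \<in> \<Lambda>" "\<And>x. x \<in> \<Lambda> \<Longrightarrow> norm (\<sigma> x - (x + \<tau>)) < \<eta>"
    using \<tau> by metis
  define s where "s x = \<sigma> x - (x + \<tau>)" for x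
  have s_step: "s u = s v" if uv: "u \<in> \<Lambda>" "v \<in> \<Lambda>" "dist u v \<le> 2 * R + 1" for u v
  proof -
    have eq: "(\<sigma> u - \<sigma> v) - (u - v) = s u - s v" by (simp add: s_def)
    have s: "norm (s u) < \<eta>" "norm (s v) < \<eta>" using \<sigma> uv unfolding s_def by blast+
    have small: "norm (s u - s v) < 2 * \<eta>"
      using norm_triangle_ineq4[of "s u" "s v"] s by linarith
    have "\<sigma> u - \<sigma> v = (u - v) + (s u - s v)" by (simp add: s_def)
    then have "norm (\<sigma> u - \<sigma> v) \<le> dist u v + norm (s u - s v)"
      by (metis dist_norm norm_triangle_ineq)
    then have "norm (\<sigma> u - \<sigma> v) \<le> 2 * R + 3" using small uv \<eta> by linarith
    then have "\<sigma> u - \<sigma> v = u - v"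
      using uv \<sigma>(1) small \<eta> eq by (intro \<kappa>) (auto intro: difference_setI simp: dist_norm norm_minus_commute)
    then show ?thesis using eq by simp
  qed
  obtain z where z: "z \<in> \<Lambda>" using dense by blast
  have "s x = s z" if "x \<in> \<Lambda>" for x
    using constant_along_chains[of \<Lambda> R s, OF dense s_step that z] by blast
  then have "x + (\<tau> + s z) \<in> \<Lambda>" if "x \<in> \<Lambda>" for x
    using \<sigma>(1)[OF that] that s_def[of x] by (metis add.assoc add.commute diff_add_cancel)
  moreover have "norm (s z) < \<eta>" using \<sigma>(2)[OF z] by (simp add: s_def)
  ultimately show ?thesis by blast
qed

text \<open>The rigidity step applied to \<open>\<tau>\<close> and to \<open>-\<tau>\<close> gives translations by \<open>\<tau> + s\<close> and \<open>-\<tau> + s'\<close> that map \<open>\<Lambda>\<close>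
  into itself. Their composition moves the points of \<open>\<Lambda>\<close> by \<open>s + s'\<close>, a difference so short that it
  has to vanish; hence the two are inverse to each other.\<close>

lemma relatively_dense_periods:
  fixes \<Lambda> :: "(real^'d::finite) set"
  assumes discrete: "discrete_set (difference_set \<Lambda>)" and ne: "\<Lambda> \<noteq> {}"
    and dense: "\<And>\<eta>. \<eta> > 0 \<Longrightarrow> relatively_dense (almost_translates \<Lambda> \<eta>)"
  shows "relatively_dense (periods \<Lambda>)"
proof -
  obtain z where z: "z \<in> \<Lambda>" using ne by blast
  obtain R0 where R0: "\<And>x. \<exists>\<tau>\<in>almost_translates \<Lambda> 1. dist x \<tau> < R0"
    using dense[of 1] unfolding relatively_dense_def by auto
  define R where "R = R0 + 1"
  have \<Lambda>_dense: "\<exists>y\<in>\<Lambda>. dist x y < R" for x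
  proof -
    obtain \<tau> where \<tau>: "\<tau> \<in> almost_translates \<Lambda> 1" "dist (x - z) \<tau> < R0" using R0 by blast
    obtain y where y: "y \<in> \<Lambda>" "norm (y - (z + \<tau>)) < 1"
      using \<tau>(1) z unfolding almost_translates_def by blast
    have "dist x y \<le> dist (x - z) \<tau> + norm (y - (z + \<tau>))"
      using norm_triangle_ineq4[of "x - z - \<tau>" "y - (z + \<tau>)"] by (simp add: dist_norm)
    then show ?thesis using y \<tau> unfolding R_def by (intro bexI[of _ y]) auto
  qed
  have "R > 0" using \<Lambda>_dense[of z] by (auto intro: le_less_trans[OF zero_le_dist])
  obtain \<kappa> where \<kappa>: "\<kappa> > 0" "\<And>u v. u \<in> difference_set \<Lambda> \<inter> cball 0 (2 * R + 3) \<Longrightarrow>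
        v \<in> difference_set \<Lambda> \<inter> cball 0 (2 * R + 3) \<Longrightarrow> dist u v < \<kappa> \<Longrightarrow> u = v"
    by (rule finite_set_separated[OF discrete_set_finite_cball[OF discrete, of 0 "2 * R + 3"]]) blast
  define \<eta> where "\<eta> = min 1 (\<kappa> / 2)"
  have \<eta>: "\<eta> > 0" "2 * \<eta> \<le> \<kappa>" "\<eta> \<le> 1" using \<kappa>(1) unfolding \<eta>_def by auto
  note shift = almost_translates_shift_constant[of \<Lambda> R \<kappa> \<eta>, OF \<Lambda>_dense \<kappa>(2) \<eta>(2,3)]
  have near: "\<exists>p\<in>periods \<Lambda>. dist \<tau> p < \<eta>" if \<tau>: "\<tau> \<in> almost_translates \<Lambda> \<eta>" for \<tau>
  proof -
    obtain s where s: "norm s < \<eta>" "\<forall>x\<in>\<Lambda>. x + (\<tau> + s) \<in> \<Lambda>"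
      using shift[of \<tau>] \<tau> unfolding almost_translates_def by blast
    obtain s' where s': "norm s' < \<eta>" "\<forall>x\<in>\<Lambda>. x + (- \<tau> + s') \<in> \<Lambda>"
      using shift[of "- \<tau>"] \<tau> unfolding almost_translates_def by auto
    have "z + (\<tau> + s) + (- \<tau> + s') \<in> \<Lambda>" using s s' z by blast
    then have "z + (s + s') \<in> \<Lambda>" by (simp add: algebra_simps)
    then have "s + s' \<in> difference_set \<Lambda>" using difference_setI[of "z + (s + s')" \<Lambda> z] z by simp
    moreover have "norm (s + s') < 2 * \<eta>" using norm_triangle_ineq[of s s'] s s' by linarith
    moreover have "0 \<in> difference_set \<Lambda>" using difference_setI[OF z z] by simp
    ultimately have "s + s' = 0"
      using \<eta> \<open>R > 0\<close> by (intro \<kappa>(2)) auto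
    then have "s' = - s" by (simp add: add_eq_0_iff)
    then have "\<tau> + s \<in> periods \<Lambda>"
      using s(2) s'(2) unfolding periods_def by (simp add: algebra_simps)
    moreover have "dist \<tau> (\<tau> + s) < \<eta>" using s by (simp add: dist_norm)
    ultimately show ?thesis by blast
  qed
  obtain R1 where R1: "\<And>x. \<exists>\<tau>\<in>almost_translates \<Lambda> \<eta>. dist x \<tau> < R1"
    using dense[OF \<eta>(1)] unfolding relatively_dense_def by auto
  have "\<exists>p\<in>periods \<Lambda>. dist x p < R1 + \<eta>" for x
    using R1[of x] near by (meson add_strict_mono dist_triangle order_le_less_trans)
  then show ?thesis unfolding relatively_dense_def by blast
qed

text \<open>The whole group of periods need not be analysed, because a sublattice of full rank suffices: periods
  \<open>p i\<close> within distance \<open>R\<close> of \<open>K\<close> times the coordinate vectors form a diagonally dominant, hence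
  nondegenerate, system as soon as \<open>K\<close> is at least the dimension times \<open>R\<close>.\<close>

lemma finite_union_of_lattice_translates:
  fixes \<Lambda> :: "(real^'d::finite) set"
  assumes fin: "\<And>r. finite (\<Lambda> \<inter> cball 0 r)" and dense: "relatively_dense (periods \<Lambda>)"
  shows "\<exists>L F. full_rank_lattice L \<and> finite F \<and> \<Lambda> = (\<Union>v\<in>F. (+) v ` L)"
proof -
  obtain R where R: "\<And>x. \<exists>p\<in>periods \<Lambda>. dist x p < R"
    using dense unfolding relatively_dense_def by auto
  have "R > 0" using R[of 0] zero_le_dist le_less_trans by blast
  define K where "K = real CARD('d) * R"
  have "\<forall>i. \<exists>q. q \<in> periods \<Lambda> \<and> dist (K *\<^sub>R axis i 1) q < R"
    using R by blast
  then obtain p where p: "\<And>i. p i \<in> periods \<Lambda>" "\<And>i. dist (K *\<^sub>R axis i 1) (p i) < R"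
    by metis
  define T where "T x = (\<Sum>i\<in>UNIV. x $ i *\<^sub>R p i)" for x :: "real^'d"
  have lin: "linear T"
    by (auto simp: T_def linear_iff scaleR_add_left sum.distrib scaleR_sum_right)
  have "x = 0" if "T x = 0" for x
  proof (rule ccontr)
    assume "x \<noteq> 0"
    have "K *\<^sub>R x = (\<Sum>i\<in>UNIV. x $ i *\<^sub>R (K *\<^sub>R axis i 1))"
      by (simp add: vec_eq_iff axis_def if_distrib cong: if_cong)
    also have "\<dots> = (\<Sum>i\<in>UNIV. x $ i *\<^sub>R (K *\<^sub>R axis i 1 - p i))"
      using that unfolding T_def by (simp add: scaleR_diff_right sum_subtractf)
    finally have eq: "K *\<^sub>R x = (\<Sum>i\<in>UNIV. x $ i *\<^sub>R (K *\<^sub>R axis i 1 - p i))" .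
    obtain j where j: "x $ j \<noteq> 0" using \<open>x \<noteq> 0\<close> by (auto simp: vec_eq_iff)
    \<comment> \<open>A kernel vector would satisfy \<open>K * norm x < CARD('d) * R * norm x\<close>, contradicting the choice of \<open>K\<close>.\<close>
    have "norm (K *\<^sub>R x) \<le> (\<Sum>i\<in>UNIV. \<bar>x $ i\<bar> * norm (K *\<^sub>R axis i 1 - p i))"
      unfolding eq by (rule order.trans[OF norm_sum]) simp
    also have "\<dots> < (\<Sum>i\<in>(UNIV::'d set). norm x * R)"
    proof (rule sum_strict_mono_ex1)
      show "\<forall>i\<in>UNIV. \<bar>x $ i\<bar> * norm (K *\<^sub>R axis i 1 - p i) \<le> norm x * R"
        using p(2) by (auto intro!: mult_mono component_le_norm_cart simp: dist_norm less_imp_le)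
      have "\<bar>x $ j\<bar> * norm (K *\<^sub>R axis j 1 - p j) < \<bar>x $ j\<bar> * R"
        using j p(2)[of j] by (simp add: dist_norm)
      also have "\<dots> \<le> norm x * R"
        using \<open>R > 0\<close> by (intro mult_right_mono component_le_norm_cart) auto
      finally show "\<exists>i\<in>UNIV. \<bar>x $ i\<bar> * norm (K *\<^sub>R axis i 1 - p i) < norm x * R" by blast
    qed simp
    also have "\<dots> = norm (K *\<^sub>R x)" using \<open>R > 0\<close> by (simp add: K_def)
    finally show False by simp
  qed
  then have "inj T" by (simp add: linear_injective_0[OF lin])
  then have "bij T" using lin by (simp add: bij_def linear_injective_imp_surjective)
  define L where "L = T ` {x. \<forall>i. x $ i \<in> \<int>}"
  have L: "full_rank_lattice L" using lin \<open>bij T\<close> unfolding full_rank_lattice_def L_def by blast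
  have L_periods: "L \<subseteq> periods \<Lambda>"
    unfolding L_def T_def by (auto intro!: periods_sum periods_scaleR_int p)
  define F where "F = \<Lambda> \<inter> cball 0 (\<Sum>i\<in>UNIV. norm (p i))"
  have "\<exists>v\<in>F. x \<in> (+) v ` L" if x: "x \<in> \<Lambda>" for x
  proof -
    obtain y where y: "x = T y" using \<open>bij T\<close> by (metis bij_pointE)
    \<comment> \<open>Rounding the coordinates down moves the point into the fundamental cell, which is bounded.\<close>
    define n :: "real^'d" where "n = (\<chi> i. of_int \<lfloor>y $ i\<rfloor>)"
    have n: "T n \<in> L" unfolding L_def n_def by auto
    have "x - T n = T (y - n)" using y lin by (simp add: linear_diff)
    also have "norm \<dots> \<le> (\<Sum>i\<in>UNIV. norm ((y - n) $ i *\<^sub>R p i))"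
      unfolding T_def by (rule norm_sum)
    also have "\<dots> \<le> (\<Sum>i\<in>UNIV. norm (p i))"
    proof (rule sum_mono)
      fix i
      have "\<bar>(y - n) $ i\<bar> \<le> 1" unfolding n_def by simp linarith
      then show "norm ((y - n) $ i *\<^sub>R p i) \<le> norm (p i)"
        using mult_right_mono[of "\<bar>(y - n) $ i\<bar>" 1 "norm (p i)"] by simp
    qed
    finally have "x - T n \<in> F"
      using L_periods n x unfolding F_def periods_def by auto
    then show ?thesis using n by (intro bexI[of _ "x - T n"]) (auto intro!: image_eqI[of _ _ "T n"])
  qed
  moreover have "v + l \<in> \<Lambda>" if "v \<in> F" "l \<in> L" for v l
    using L_periods that unfolding F_def periods_def by auto
  ultimately have "\<Lambda> = (\<Union>v\<in>F. (+) v ` L)" by blast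
  moreover have "finite F" unfolding F_def by (rule fin)
  ultimately show ?thesis using L by blast
qed

section \<open>Almost periods of absolutely convergent character sums\<close>

definition character :: "'a::real_inner \<Rightarrow> 'a \<Rightarrow> complex"
  where "character \<gamma> t = exp (2 * of_real pi * \<i> * of_real (t \<bullet> \<gamma>))"

lemma norm_character [simp]: "norm (character \<gamma> t) = 1"
  by (simp add: character_def)

lemma character_add: "character \<gamma> (s + t) = character \<gamma> s * character \<gamma> t"
  by (simp add: character_def inner_add_left distrib_left exp_add)

text \<open>A pigeonhole argument: partition the bounded range of the vector of characters into finitely many
  cells and choose one representative for every cell that occurs. The difference between \<open>x\<close> and the
  representative of its cell is an almost period, and the representatives are bounded.\<close>

lemma relatively_dense_simultaneous_almost_periods:
  fixes G :: "'a::real_inner set"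
  assumes fin: "finite G" and \<delta>: "\<delta> > 0"
  shows "relatively_dense {\<tau>. \<forall>\<gamma>\<in>G. norm (character \<gamma> \<tau> - 1) < \<delta>}"
proof -
  obtain N :: nat where N: "N > 0" "2 / real N < \<delta>"
  proof -
    obtain N :: nat where "2 / \<delta> < real N" using reals_Archimedean2 by blast
    moreover have "0 < 2 / \<delta>" using \<delta> by simp
    ultimately have "2 / \<delta> < real N" "real N > 0" by linarith+
    moreover from this have "2 / real N < \<delta>" using \<delta> by (simp add: field_simps)
    ultimately show ?thesis by (intro that[of N]) auto
  qed
  define cell where "cell z = (\<lfloor>real N * Re z\<rfloor>, \<lfloor>real N * Im z\<rfloor>)" for z
  have close: "norm (z - w) < \<delta>" if "cell z = cell w" for z w
  proof -
    have "\<lfloor>real N * Re z\<rfloor> = \<lfloor>real N * Re w\<rfloor>" "\<lfloor>real N * Im z\<rfloor> = \<lfloor>real N * Im w\<rfloor>"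
      using that by (simp_all add: cell_def)
    then have "\<bar>real N * Re z - real N * Re w\<bar> \<le> 1" "\<bar>real N * Im z - real N * Im w\<bar> \<le> 1" by linarith+
    then have "real N * (\<bar>Im (z - w)\<bar> + \<bar>Re (z - w)\<bar>) \<le> 2"
      by (simp add: abs_mult distrib_left flip: right_diff_distrib)
    then have "norm (z - w) \<le> 2 / real N"
      using N(1) mult_left_mono[OF cmod_le[of "z - w"], of "real N"]
      by (simp add: field_simps)
    then show ?thesis using N by simp
  qed
  have cell: "cell z \<in> {-int N..int N} \<times> {-int N..int N}" if "norm z = 1" for z
  proof -
    have "\<bar>Re z\<bar> \<le> 1" "\<bar>Im z\<bar> \<le> 1" using that abs_Re_le_cmod[of z] abs_Im_le_cmod[of z] by auto
    then have "\<bar>real N * Re z\<bar> \<le> real N" "\<bar>real N * Im z\<bar> \<le> real N"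
      by (simp_all add: abs_mult mult_left_le)
    then show ?thesis unfolding cell_def by simp linarith
  qed
  define sig where "sig \<tau> = (\<lambda>\<gamma>\<in>G. cell (character \<gamma> \<tau>))" for \<tau>
  have "range sig \<subseteq> (\<Pi>\<^sub>E \<gamma>\<in>G. {-int N..int N} \<times> {-int N..int N})"
  proof (rule image_subsetI, rule PiE_I)
    show "sig \<tau> \<gamma> \<in> {-int N..int N} \<times> {-int N..int N}" if "\<gamma> \<in> G" for \<tau> \<gamma>
      using cell[OF norm_character, of \<gamma> \<tau>] that by (simp only: sig_def restrict_apply if_True)
  qed (simp add: sig_def)
  then have "finite (range sig)"
    by (rule finite_subset) (use fin in \<open>intro finite_PiE finite_cartesian_product; simp\<close>)
  define V where "V = inv sig ` range sig"
  have V: "finite V" using \<open>finite (range sig)\<close> unfolding V_def by simp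
  have "\<exists>\<tau>\<in>{\<tau>. \<forall>\<gamma>\<in>G. norm (character \<gamma> \<tau> - 1) < \<delta>}. dist x \<tau> < (\<Sum>v\<in>V. norm v) + 1" for x
  proof -
    define v where "v = inv sig (sig x)"
    have sig: "sig v = sig x" unfolding v_def by (simp add: f_inv_into_f)
    have "norm (character \<gamma> (x - v) - 1) < \<delta>" if "\<gamma> \<in> G" for \<gamma>
    proof -
      have "cell (character \<gamma> x) = cell (character \<gamma> v)"
        using fun_cong[OF sig, of \<gamma>] that by (simp add: sig_def)
      then have "norm (character \<gamma> x - character \<gamma> v) < \<delta>" by (rule close)
      moreover have "character \<gamma> x - character \<gamma> v = (character \<gamma> (x - v) - 1) * character \<gamma> v"
        using character_add[of \<gamma> "x - v" v] by (simp add: algebra_simps)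
      ultimately show ?thesis by (simp add: norm_mult)
    qed
    moreover have "norm v \<le> (\<Sum>v\<in>V. norm v)"
      using V by (intro member_le_sum) (auto simp: V_def v_def)
    then have "dist x (x - v) < (\<Sum>v\<in>V. norm v) + 1" by (simp add: dist_norm)
    ultimately show ?thesis by blast
  qed
  then show ?thesis unfolding relatively_dense_def by blast
qed

text \<open>Up to a tail of small total mass only finitely many characters matter, so that the preceding
  lemma applies; in the tail the crude bound \<open>2\<close> on the variation of a character is enough.\<close>

lemma relatively_dense_almost_periods:
  fixes c :: "'a::real_inner \<Rightarrow> complex"
  assumes c: "(\<lambda>\<gamma>. norm (c \<gamma>)) summable_on \<Gamma>" and \<epsilon>: "\<epsilon> > 0"
    and F: "\<And>t. F t = (\<Sum>\<^sub>\<infinity>\<gamma>\<in>\<Gamma>. c \<gamma> * character \<gamma> t)"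
  shows "relatively_dense {\<tau>. \<forall>t. norm (F (t + \<tau>) - F t) < \<epsilon>}"
proof -
  let ?S = "\<lambda>X. \<Sum>\<^sub>\<infinity>\<gamma>\<in>X. norm (c \<gamma>)"
  have c_sub: "(\<lambda>\<gamma>. norm (c \<gamma>)) summable_on X" if "X \<subseteq> \<Gamma>" for X
    using c that summable_on_subset_banach by blast
  have "?S \<Gamma> \<ge> 0" by (intro infsum_nonneg) auto
  obtain G where G: "finite G" "G \<subseteq> \<Gamma>" "dist (\<Sum>\<gamma>\<in>G. norm (c \<gamma>)) (?S \<Gamma>) \<le> \<epsilon> / 8"
    using infsum_finite_approximation[OF c, of "\<epsilon> / 8"] \<epsilon> by auto
  have split: "infsum h \<Gamma> = sum h G + infsum h (\<Gamma> - G)" if "h summable_on \<Gamma>" for h :: "'a \<Rightarrow> real"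
  proof -
    have "infsum h (G \<union> (\<Gamma> - G)) = infsum h G + infsum h (\<Gamma> - G)"
      using that G by (intro infsum_Un_disjoint) (auto intro: summable_on_subset_banach)
    moreover have "G \<union> (\<Gamma> - G) = \<Gamma>" using G by blast
    ultimately show ?thesis using G by simp
  qed
  have tail: "?S (\<Gamma> - G) \<le> \<epsilon> / 8"
    using split[OF c] G(3) by (simp add: dist_real_def)
  define \<delta> where "\<delta> = \<epsilon> / (4 * (?S \<Gamma> + 1))"
  have \<delta>: "\<delta> > 0" "\<delta> * ?S \<Gamma> \<le> \<epsilon> / 4"
    using \<epsilon> \<open>?S \<Gamma> \<ge> 0\<close> unfolding \<delta>_def by (auto simp: field_simps)
  have "norm (F (t + \<tau>) - F t) < \<epsilon>" if \<tau>: "\<And>\<gamma>. \<gamma> \<in> G \<Longrightarrow> norm (character \<gamma> \<tau> - 1) < \<delta>" for t \<tau>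
  proof -
    let ?h = "\<lambda>\<gamma>. norm (c \<gamma> * character \<gamma> t * (character \<gamma> \<tau> - 1))"
    have two: "norm (character \<gamma> \<tau> - 1) \<le> 2" for \<gamma>
      using norm_triangle_ineq4[of "character \<gamma> \<tau>" 1] by simp
    have h_le: "?h \<gamma> \<le> norm (c \<gamma>) * 2" for \<gamma>
      using two by (auto simp: norm_mult intro!: mult_left_mono)
    have c2: "(\<lambda>\<gamma>. norm (c \<gamma>) * 2) summable_on X" if "X \<subseteq> \<Gamma>" for X
      using c_sub[OF that] by (rule summable_on_cmult_left)
    have h: "?h summable_on X" if "X \<subseteq> \<Gamma>" for X
      by (rule summable_on_comparison_test[OF c2[OF that] h_le]) auto
    have sm: "(\<lambda>\<gamma>. c \<gamma> * character \<gamma> s) summable_on \<Gamma>" for s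
      by (rule abs_summable_summable) (use c in \<open>simp add: norm_mult\<close>)
    have "F (t + \<tau>) = (\<Sum>\<^sub>\<infinity>\<gamma>\<in>\<Gamma>. c \<gamma> * character \<gamma> t + c \<gamma> * character \<gamma> t * (character \<gamma> \<tau> - 1))"
      unfolding F by (simp add: character_add algebra_simps)
    also have "\<dots> = F t + (\<Sum>\<^sub>\<infinity>\<gamma>\<in>\<Gamma>. c \<gamma> * character \<gamma> t * (character \<gamma> \<tau> - 1))"
      unfolding F by (intro infsum_add sm abs_summable_summable[OF h]) simp
    finally have "norm (F (t + \<tau>) - F t) \<le> infsum ?h \<Gamma>"
      using norm_infsum_bound[OF h[OF order_refl]] by (simp del: norm_mult)
    also have "\<dots> = sum ?h G + infsum ?h (\<Gamma> - G)" by (rule split[OF h]) simp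
    also have "sum ?h G \<le> (\<Sum>\<gamma>\<in>G. \<delta> * norm (c \<gamma>))"
      using \<tau> by (intro sum_mono) (simp add: norm_mult mult.commute[of \<delta>] mult_left_mono less_imp_le)
    also have "\<dots> \<le> \<delta> * ?S \<Gamma>"
      using \<delta> G finite_sum_le_infsum[OF c, of G] by (simp add: sum_distrib_left[symmetric])
    also have "infsum ?h (\<Gamma> - G) \<le> (\<Sum>\<^sub>\<infinity>\<gamma>\<in>\<Gamma> - G. norm (c \<gamma>) * 2)"
      by (intro infsum_mono h c2 h_le) auto
    also have "\<dots> = ?S (\<Gamma> - G) * 2" by (rule infsum_cmult_left')
    finally show ?thesis using \<delta> tail \<epsilon> by linarith
  qed
  then show ?thesis
    by (intro relatively_dense_mono[OF relatively_dense_simultaneous_almost_periods[OF G(1) \<delta>(1)]]) blast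
qed

lemma norm_character_sum_le:
  assumes "(\<lambda>\<gamma>. norm (c \<gamma>)) summable_on \<Gamma>"
  shows "norm (\<Sum>\<^sub>\<infinity>\<gamma>\<in>\<Gamma>. c \<gamma> * character \<gamma> t) \<le> (\<Sum>\<^sub>\<infinity>\<gamma>\<in>\<Gamma>. norm (c \<gamma>))"
  using norm_infsum_bound[of "\<lambda>\<gamma>. c \<gamma> * character \<gamma> t" \<Gamma>] assms by (simp add: norm_mult)

section \<open>Weighted sums over shells\<close>

lemma summable_inverse_Suc_squares: "summable (\<lambda>n. 1 / (real n + 1)\<^sup>2)"
proof -
  have "summable (\<lambda>n. inverse (real n ^ 2))"
    by (rule inverse_power_summable) simp
  then have "summable (\<lambda>n. inverse (real (Suc n) ^ 2))" by (subst summable_Suc_iff)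
  then show ?thesis by (simp add: field_simps add.commute)
qed

text \<open>Polynomial growth of the mass in balls around \<open>t\<close> makes every weight of sufficiently fast decay
  summable. Each point is compared with the shell \<open>n \<le> dist x t < n + 1\<close> containing it: that shell has
  mass at most \<open>C * (n + 1) ^ N\<close>, and the exponent \<open>N + 2\<close> leaves the convergent series of inverse
  squares. The bound does not depend on the centre, which makes it uniform in \<open>t\<close> for sets whose
  growth is.\<close>

lemma sum_shells_le:
  fixes u :: "'a::metric_space \<Rightarrow> real"
  assumes fin: "finite A" and u: "\<And>x. x \<in> A \<Longrightarrow> u x \<ge> 0"
    and growth: "\<And>n::nat. sum u (A \<inter> ball t (real n + 1)) \<le> C * (real n + 1) ^ N"
  shows "(\<Sum>x\<in>A. u x / (1 + dist x t) ^ (N + 2)) \<le> C * (\<Sum>n. 1 / (real n + 1)\<^sup>2)"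
proof -
  have "0 \<le> sum u (A \<inter> ball t (real 0 + 1))" using u by (intro sum_nonneg) auto
  then have C: "C \<ge> 0" using growth[of 0] by simp
  define g where "g x = nat \<lfloor>dist x t\<rfloor>" for x
  have g: "real (g x) \<le> dist x t" "dist x t < real (g x) + 1" for x
    unfolding g_def by (simp_all add: of_nat_nat)
  have "(\<Sum>x\<in>A. u x / (1 + dist x t) ^ (N + 2)) \<le> (\<Sum>x\<in>A. u x / (real (g x) + 1) ^ (N + 2))"
    using g(1) u by (intro sum_mono divide_left_mono power_mono mult_pos_pos zero_less_power)
      (auto intro: add_pos_nonneg add_nonneg_pos simp: add.commute)
  also have "\<dots> = (\<Sum>n\<in>g ` A. \<Sum>x\<in>{x \<in> A. g x = n}. u x / (real (g x) + 1) ^ (N + 2))"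
    using fin by (rule sum.image_gen)
  also have "\<dots> \<le> (\<Sum>n\<in>g ` A. C * (1 / (real n + 1)\<^sup>2))"
  proof (rule sum_mono)
    fix n
    have "(\<Sum>x\<in>{x \<in> A. g x = n}. u x / (real (g x) + 1) ^ (N + 2))
        = (\<Sum>x\<in>{x \<in> A. g x = n}. u x) / (real n + 1) ^ (N + 2)"
      by (simp add: sum_divide_distrib)
    also have "\<dots> \<le> sum u (A \<inter> ball t (real n + 1)) / (real n + 1) ^ (N + 2)"
      using fin u g(2) by (intro divide_right_mono sum_mono2) (auto simp: dist_commute)
    also have "\<dots> \<le> C * (real n + 1) ^ N / (real n + 1) ^ (N + 2)"
      using growth by (intro divide_right_mono) auto
    also have "\<dots> = C * (1 / (real n + 1)\<^sup>2)"
      by (simp add: power_add power2_eq_square)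
    finally show "(\<Sum>x\<in>{x \<in> A. g x = n}. u x / (real (g x) + 1) ^ (N + 2))
      \<le> C * (1 / (real n + 1)\<^sup>2)" .
  qed
  also have "\<dots> = C * (\<Sum>n\<in>g ` A. 1 / (real n + 1)\<^sup>2)" by (simp add: sum_distrib_left)
  also have "\<dots> \<le> C * (\<Sum>n. 1 / (real n + 1)\<^sup>2)"
    using C fin by (intro mult_left_mono sum_le_suminf summable_inverse_Suc_squares) auto
  finally show ?thesis .
qed

text \<open>The balls of radius \<open>g / 2\<close> around the points are disjoint and contained in a ball of radius
  \<open>r + g / 2\<close>; compare volumes.\<close>

lemma card_separated_le:
  fixes A :: "'a::euclidean_space set"
  assumes fin: "finite A" and g: "g > 0" and r: "r > 0"
    and sep: "\<And>x y. x \<in> A \<Longrightarrow> y \<in> A \<Longrightarrow> x \<noteq> y \<Longrightarrow> g \<le> dist x y"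
    and ball: "A \<subseteq> ball t r"
  shows "real (card A) \<le> (1 + 2 * r / g) ^ DIM('a)"
proof -
  let ?v = "unit_ball_vol (real DIM('a))"
  have v: "?v > 0" by (rule unit_ball_vol_pos) simp
  have disj: "disjoint_family_on (\<lambda>x. ball x (g / 2)) A"
    unfolding disjoint_family_on_def
  proof (intro ballI impI)
    fix x y assume "x \<in> A" "y \<in> A" "x \<noteq> y"
    then have "g \<le> dist x y" by (rule sep)
    then show "ball x (g / 2) \<inter> ball y (g / 2) = {}"
      by (intro disjoint_ballI) simp
  qed
  have "real (card A) * (?v * (g / 2) ^ DIM('a)) = (\<Sum>x\<in>A. measure lborel (ball x (g / 2)))"
    using g by (simp add: content_ball)
  also have "\<dots> = measure lborel (\<Union>x\<in>A. ball x (g / 2))"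
    using fin disj by (intro measure_finite_Union[symmetric]) (use emeasure_lborel_ball_finite in \<open>auto simp: less_top\<close>)
  also have "\<dots> \<le> measure lborel (ball t (r + g / 2))"
  proof (rule measure_mono_fmeasurable)
    show "(\<Union>x\<in>A. ball x (g / 2)) \<subseteq> ball t (r + g / 2)"
    proof
      fix z assume "z \<in> (\<Union>x\<in>A. ball x (g / 2))"
      then obtain x where "x \<in> A" "dist x z < g / 2" by auto
      moreover from this have "dist t x < r" using ball by auto
      ultimately show "z \<in> ball t (r + g / 2)"
        using dist_triangle[of t z x] by simp
    qed
    show "(\<Union>x\<in>A. ball x (g / 2)) \<in> sets lborel" by (auto intro!: borel_open)
    show "ball t (r + g / 2) \<in> fmeasurable lborel"
      using emeasure_lborel_ball_finite by (auto intro!: fmeasurableI)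
  qed
  also have "\<dots> = ?v * (r + g / 2) ^ DIM('a)"
    using g r by (simp add: content_ball)
  also have "r + g / 2 = (1 + 2 * r / g) * (g / 2)" using g by (simp add: field_simps)
  finally have "real (card A) * (?v * (g / 2) ^ DIM('a))
      \<le> (1 + 2 * r / g) ^ DIM('a) * (?v * (g / 2) ^ DIM('a))"
    by (simp only: power_mult_distrib mult_ac)
  moreover have "?v * (g / 2) ^ DIM('a) > 0" using v g by simp
  ultimately show ?thesis by (simp only: mult_le_cancel_right_pos)
qed

lemma power_div_fact_le_exp:
  fixes x :: real
  assumes "x \<ge> 0"
  shows "x ^ n / fact n \<le> exp x"
proof -
  have "(\<Sum>k\<in>{n}. x ^ k /\<^sub>R fact k) \<le> (\<Sum>k. x ^ k /\<^sub>R fact k)"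
    using assms by (intro sum_le_suminf summable_exp_generic) auto
  then show ?thesis by (simp add: exp_def divide_inverse mult.commute)
qed

text \<open>By completing the square, \<open>exp (- c * r\<^sup>2)\<close> is at most a multiple of \<open>exp (- r)\<close>, and the exponential
  series bounds \<open>(1 + r) ^ M\<close> by \<open>fact M * exp (1 + r)\<close>.\<close>

lemma gaussian_decay:
  fixes c :: real
  assumes "c > 0"
  shows "\<exists>B>0. \<forall>r\<ge>0. (1 + r) ^ M * exp (- c * r\<^sup>2) \<le> B"
proof (intro exI conjI allI impI)
  show "fact M * exp (1 + 1 / (4 * c)) > (0::real)" by simp
  fix r :: real assume r: "r \<ge> 0"
  have "(1 + r) ^ M / fact M \<le> exp (1 + r)"
    using r by (intro power_div_fact_le_exp) auto
  have "0 \<le> c * (r - 1 / (2 * c))\<^sup>2" using assms by simp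
  also have "\<dots> = c * r\<^sup>2 - r + 1 / (4 * c)"
    using assms by (simp add: power2_eq_square field_simps)
  finally have "exp (- c * r\<^sup>2) \<le> exp (1 / (4 * c) - r)" by simp
  then have "(1 + r) ^ M * exp (- c * r\<^sup>2) \<le> (fact M * exp (1 + r)) * exp (1 / (4 * c) - r)"
    using r \<open>(1 + r) ^ M / fact M \<le> exp (1 + r)\<close>
    by (intro mult_mono) (auto simp: field_simps)
  also have "\<dots> = fact M * exp (1 + 1 / (4 * c))"
    by (simp add: mult.assoc flip: exp_add)
  finally show "(1 + r) ^ M * exp (- c * r\<^sup>2) \<le> fact M * exp (1 + 1 / (4 * c))" .
qed

text \<open>Away from the origin, a sufficiently narrow Gaussian lies below any given multiple of any given
  power. The factor \<open>exp (- r\<^sup>2)\<close> is kept to absorb the power, and the remaining exponent \<open>p\<close> is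
  chosen to turn the resulting constant into \<open>\<epsilon>\<close>.\<close>

lemma gaussian_sharp:
  fixes \<eta> \<epsilon> :: real
  assumes "\<eta> > 0" "\<epsilon> > 0"
  shows "\<exists>q>0. \<forall>r\<ge>\<eta>. exp (- q * r\<^sup>2) \<le> \<epsilon> / (1 + r) ^ M"
proof -
  obtain B :: real where B: "B > 0" "\<forall>r\<ge>0. (1 + r) ^ M * exp (- 1 * r\<^sup>2) \<le> B"
    using gaussian_decay[OF zero_less_one, where M = M] by blast
  define p where "p = max 0 (ln (B / \<epsilon>) / \<eta>\<^sup>2)"
  have "ln (B / \<epsilon>) / \<eta>\<^sup>2 \<le> p" "p \<ge> 0" by (simp_all add: p_def)
  then have p: "p \<ge> 0" "ln (B / \<epsilon>) \<le> p * \<eta>\<^sup>2"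
    using assms by (simp_all add: pos_divide_le_eq)
  have Bp: "B * exp (- p * \<eta>\<^sup>2) \<le> \<epsilon>"
  proof -
    have "B / \<epsilon> = exp (ln (B / \<epsilon>))" using B assms by simp
    also have "\<dots> \<le> exp (p * \<eta>\<^sup>2)" using p by simp
    finally show ?thesis using assms by (simp add: field_simps exp_minus)
  qed
  have "exp (- (1 + p) * r\<^sup>2) \<le> \<epsilon> / (1 + r) ^ M" if r: "r \<ge> \<eta>" for r
  proof -
    have "(1 + r) ^ M * exp (- (1 + p) * r\<^sup>2) = ((1 + r) ^ M * exp (- 1 * r\<^sup>2)) * exp (- p * r\<^sup>2)"
      by (simp add: algebra_simps flip: exp_add)
    also have "\<dots> \<le> B * exp (- p * \<eta>\<^sup>2)"
      using B assms r p by (intro mult_mono B(2)[rule_format]) (auto intro!: mult_left_mono power_mono)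
    also note Bp
    finally show ?thesis using r assms by (simp add: field_simps)
  qed
  then show ?thesis using p by (intro exI[of _ "1 + p"]) simp
qed

section \<open>Modulated Gaussians\<close>

text \<open>Polynomial functions in several real variables with complex values. They are the prefactors that
  arise when Gaussians are differentiated repeatedly.\<close>

inductive polynomial_fun :: "(real^'d::finite \<Rightarrow> complex) \<Rightarrow> bool" where
  const: "polynomial_fun (\<lambda>x. c)"
| coord: "polynomial_fun (\<lambda>x. of_real (x $ i))"
| add: "polynomial_fun f \<Longrightarrow> polynomial_fun g \<Longrightarrow> polynomial_fun (\<lambda>x. f x + g x)"
| mult: "polynomial_fun f \<Longrightarrow> polynomial_fun g \<Longrightarrow> polynomial_fun (\<lambda>x. f x * g x)"

lemma partial_deriv_eq:
  "(f has_derivative f') (at x) \<Longrightarrow> partial_deriv i f x = f' (axis i 1)"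
  unfolding partial_deriv_def by (metis frechet_derivative_at)

lemma polynomial_fun_differentiable:
  assumes "polynomial_fun p"
  shows "p differentiable (at x)"
  using assms
proof induction
  case (coord i)
  have "((\<lambda>x. of_real (x $ i)) has_derivative (\<lambda>x. of_real (x $ i) :: complex)) (at x)"
    by (intro derivative_intros bounded_linear.has_derivative[OF bounded_linear_of_real]
        bounded_linear.has_derivative[OF bounded_linear_vec_nth]) 
  then show ?case unfolding differentiable_def by blast
qed auto

lemma has_derivative_frechet:
  "f differentiable (at x) \<Longrightarrow> (f has_derivative frechet_derivative f (at x)) (at x)"
  by (simp add: frechet_derivative_works)

lemma partial_deriv_add:
  assumes "f differentiable (at x)" "g differentiable (at x)"
  shows "partial_deriv i (\<lambda>x. f x + g x) x = partial_deriv i f x + partial_deriv i g x"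
  using partial_deriv_eq[OF has_derivative_add[OF has_derivative_frechet has_derivative_frechet, OF assms]]
  by (simp add: partial_deriv_def)

lemma partial_deriv_mult:
  assumes "f differentiable (at x)" "g differentiable (at x)"
  shows "partial_deriv i (\<lambda>x. f x * g x) x = f x * partial_deriv i g x + partial_deriv i f x * g x"
  using partial_deriv_eq[OF has_derivative_mult[OF has_derivative_frechet has_derivative_frechet, OF assms]]
  by (simp add: partial_deriv_def)

lemma polynomial_fun_partial_deriv:
  assumes "polynomial_fun p"
  shows "polynomial_fun (partial_deriv i p)"
  using assms
proof induction
  case (const c)
  have "partial_deriv i (\<lambda>x. c) = (\<lambda>x. 0)"
    by (rule ext) (simp add: partial_deriv_def)
  then show ?case by (simp add: polynomial_fun.const)
next
  case (coord j)
  have "((\<lambda>x. of_real (x $ j)) has_derivative (\<lambda>x. of_real (x $ j) :: complex)) (at x)" for x :: "real^'a"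
    by (intro derivative_intros bounded_linear.has_derivative[OF bounded_linear_of_real]
        bounded_linear.has_derivative[OF bounded_linear_vec_nth]) 
  then have "partial_deriv i (\<lambda>x. of_real (x $ j)) = (\<lambda>x. of_real (axis i 1 $ j) :: complex)"
    by (intro ext partial_deriv_eq)
  then show ?case by (simp add: polynomial_fun.const)
next
  case (add f g)
  then have "partial_deriv i (\<lambda>x. f x + g x) = (\<lambda>x. partial_deriv i f x + partial_deriv i g x)"
    by (intro ext partial_deriv_add polynomial_fun_differentiable)
  then show ?case using add by (simp add: polynomial_fun.add)
next
  case (mult f g)
  then have "partial_deriv i (\<lambda>x. f x * g x) = (\<lambda>x. f x * partial_deriv i g x + partial_deriv i f x * g x)"
    by (intro ext partial_deriv_mult polynomial_fun_differentiable)
  then show ?case using mult by (simp add: polynomial_fun.intros)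
qed

lemma polynomial_fun_growth:
  assumes "polynomial_fun p"
  shows "\<exists>B n. B \<ge> 0 \<and> (\<forall>x. cmod (p x) \<le> B * (1 + norm x) ^ n)"
  using assms
proof induction
  case (const c)
  show ?case by (rule exI[of _ "cmod c"], rule exI[of _ 0]) simp
next
  case (coord i)
  have "cmod (of_real (x $ i)) \<le> 1 * (1 + norm x) ^ 1" for x :: "real^'a"
    using component_le_norm_cart[of x i] by simp
  then show ?case by (intro exI[of _ 1]) simp
next
  case (add f g)
  then obtain B n C m where *: "B \<ge> 0" "\<And>x. cmod (f x) \<le> B * (1 + norm x) ^ n"
    "C \<ge> 0" "\<And>x. cmod (g x) \<le> C * (1 + norm x) ^ m" by metis
  have "cmod (f x + g x) \<le> (B + C) * (1 + norm x) ^ (n + m)" for x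
  proof -
    have "cmod (f x + g x) \<le> B * (1 + norm x) ^ n + C * (1 + norm x) ^ m"
      using *(2,4)[of x] norm_triangle_ineq[of "f x" "g x"] by linarith
    also have "\<dots> \<le> B * (1 + norm x) ^ (n + m) + C * (1 + norm x) ^ (n + m)"
      using * by (intro add_mono mult_left_mono power_increasing) auto
    finally show ?thesis by (simp add: algebra_simps)
  qed
  then show ?case using * by (intro exI[of _ "B + C"] exI[of _ "n + m"]) simp
next
  case (mult f g)
  then obtain B n C m where *: "B \<ge> 0" "\<And>x. cmod (f x) \<le> B * (1 + norm x) ^ n"
    "C \<ge> 0" "\<And>x. cmod (g x) \<le> C * (1 + norm x) ^ m" by metis
  have "cmod (f x * g x) \<le> (B * C) * (1 + norm x) ^ (n + m)" for x
    using mult_mono[OF *(2,4)[of x]] * by (simp add: norm_mult power_add mult_ac)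
  then show ?case using * by (intro exI[of _ "B * C"] exI[of _ "n + m"]) simp
qed

text \<open>The function \<open>exp (- c |y|\<^sup>2) * exp (2 * pi * \<i> * (t \<bullet> y))\<close>. The modulation by the character of frequency
  \<open>t\<close> turns into a translation by \<open>t\<close> under the Fourier transform.\<close>

definition modulated_gaussian :: "real \<Rightarrow> real^'d::finite \<Rightarrow> real^'d \<Rightarrow> complex"
  where "modulated_gaussian c t y = exp (of_real (- c * (y \<bullet> y)) + 2 * of_real pi * \<i> * of_real (t \<bullet> y))"

lemma cmod_modulated_gaussian: "cmod (modulated_gaussian c t y) = exp (- c * (norm y)\<^sup>2)"
  by (simp add: modulated_gaussian_def dot_square_norm)

lemma modulated_gaussian_has_derivative:
  "(modulated_gaussian c t has_derivative (\<lambda>h. 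
     (of_real (- 2 * c * (y \<bullet> h)) + 2 * of_real pi * \<i> * of_real (t \<bullet> h)) * modulated_gaussian c t y)) (at y)"
proof -
  let ?e = "\<lambda>y. complex_of_real (- c * (y \<bullet> y)) + 2 * of_real pi * \<i> * of_real (t \<bullet> y)"
  have "(?e has_derivative (\<lambda>h. of_real (- c * (y \<bullet> h + h \<bullet> y)) + 2 * of_real pi * \<i> * of_real (t \<bullet> h))) (at y)"
    by (rule has_derivative_add has_derivative_mult_right has_derivative_inner has_derivative_ident
        has_derivative_inner_right bounded_linear.has_derivative[OF bounded_linear_of_real])+
  moreover have "(exp has_derivative (*) (exp (?e y))) (at (?e y))"
    using DERIV_exp[of "?e y"] unfolding has_field_derivative_def .
  ultimately have "((\<lambda>y. exp (?e y)) has_derivative (\<lambda>h. exp (?e y) *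
      (of_real (- c * (y \<bullet> h + h \<bullet> y)) + 2 * of_real pi * \<i> * of_real (t \<bullet> h)))) (at y)"
    by (rule has_derivative_compose)
  then show ?thesis
    unfolding modulated_gaussian_def
    by (rule has_derivative_eq_rhs) (simp add: fun_eq_iff inner_commute algebra_simps)
qed

lemma modulated_gaussian_differentiable: "modulated_gaussian c t differentiable (at y)"
  using modulated_gaussian_has_derivative unfolding differentiable_def by blast

lemma iter_partial_deriv_modulated_gaussian:
  "\<exists>p. polynomial_fun p \<and> iter_partial_deriv is (modulated_gaussian c t) = (\<lambda>y. p y * modulated_gaussian c t y)"
proof (induction "is")
  case Nil
  show ?case by (rule exI[of _ "\<lambda>x. 1"]) (simp add: polynomial_fun.const)
next
  case (Cons i "is")
  then obtain p where p: "polynomial_fun p"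
    "iter_partial_deriv is (modulated_gaussian c t) = (\<lambda>y. p y * modulated_gaussian c t y)" by blast
  define q where "q y = of_real (- 2 * c) * of_real (y $ i) + 2 * of_real pi * \<i> * of_real (t $ i)" for y :: "real^'a"
  have q: "polynomial_fun q"
    unfolding q_def by (intro polynomial_fun.intros)
  have dg: "partial_deriv i (modulated_gaussian c t) y = q y * modulated_gaussian c t y" for y
    using partial_deriv_eq[OF modulated_gaussian_has_derivative, of i c t y]
    by (simp add: q_def inner_axis)
  have "iter_partial_deriv (i # is) (modulated_gaussian c t) y
      = (p y * q y + partial_deriv i p y) * modulated_gaussian c t y" for y
    using partial_deriv_mult[OF polynomial_fun_differentiable[OF p(1)] modulated_gaussian_differentiable, of i c t y]
    by (simp add: p(2) dg algebra_simps)
  then show ?case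
    using p q polynomial_fun_partial_deriv[of p i]
    by (intro exI[of _ "\<lambda>y. p y * q y + partial_deriv i p y"]) (auto intro!: polynomial_fun.intros)
qed

lemma schwartz_modulated_gaussian:
  assumes "c > 0"
  shows "schwartz (modulated_gaussian c t)"
  unfolding schwartz_def
proof (intro conjI allI)
  show "smooth (modulated_gaussian c t)"
    unfolding smooth_def
  proof (intro allI)
    fix "is" x
    obtain p where p: "polynomial_fun p"
      "iter_partial_deriv is (modulated_gaussian c t) = (\<lambda>y. p y * modulated_gaussian c t y)"
      using iter_partial_deriv_modulated_gaussian by blast
    show "iter_partial_deriv is (modulated_gaussian c t) differentiable (at x)"
      unfolding p(2) by (intro derivative_intros polynomial_fun_differentiable p modulated_gaussian_differentiable)
  qed
next
  fix "is" k
  obtain p where p: "polynomial_fun p"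
    "iter_partial_deriv is (modulated_gaussian c t) = (\<lambda>y. p y * modulated_gaussian c t y)"
    using iter_partial_deriv_modulated_gaussian by blast
  obtain B n where B: "B \<ge> 0" "\<And>x. cmod (p x) \<le> B * (1 + norm x) ^ n"
    using polynomial_fun_growth[OF p(1)] by blast
  obtain C where C: "C > 0" "\<forall>r\<ge>0. (1 + r) ^ (k + n) * exp (- c * r\<^sup>2) \<le> C"
    using gaussian_decay[OF assms, where M = "k + n"] by blast
  have "norm x ^ k * cmod (iter_partial_deriv is (modulated_gaussian c t) x) \<le> B * C" for x
  proof -
    have "norm x ^ k * cmod (iter_partial_deriv is (modulated_gaussian c t) x)
        = norm x ^ k * (cmod (p x) * exp (- c * (norm x)\<^sup>2))"
      by (simp add: p(2) norm_mult cmod_modulated_gaussian)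
    also have "\<dots> \<le> (1 + norm x) ^ k * ((B * (1 + norm x) ^ n) * exp (- c * (norm x)\<^sup>2))"
      using B by (intro mult_mono power_mono) auto
    also have "\<dots> = B * ((1 + norm x) ^ (k + n) * exp (- c * (norm x)\<^sup>2))"
      by (simp add: power_add mult_ac)
    also have "\<dots> \<le> B * C" using B C by (intro mult_left_mono) auto
    finally show ?thesis .
  qed
  then show "bounded (range (\<lambda>x. norm x ^ k * cmod (iter_partial_deriv is (modulated_gaussian c t) x)))"
    unfolding bounded_iff by (intro exI[of _ "B * C"]) (auto simp: norm_mult)
qed

text \<open>This is the characteristic function of the standard normal distribution, rescaled by
  \<open>k = sqrt (2 * c)\<close>.\<close>

lemma gaussian_fourier_real:
  fixes c u :: real
  assumes c: "c > 0"
  shows "has_bochner_integral lborel (\<lambda>y. exp (of_real (- c * y\<^sup>2) + 2 * of_real pi * \<i> * of_real (u * y)))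
    (complex_of_real (sqrt (pi / c) * exp (- (pi\<^sup>2 / c) * u\<^sup>2)))"
proof -
  define k where "k = sqrt (2 * c)"
  have k: "k > 0" "k\<^sup>2 = 2 * c" using c by (auto simp: k_def)
  define s where "s = 2 * pi * u / k"
  interpret prob_space std_normal_distribution
    using real_dist_normal_dist real_distribution_def by blast
  have "integrable std_normal_distribution (\<lambda>x. iexp (s * x))"
    by (rule integrable_iexp) auto
  then have int: "integrable lborel (\<lambda>x. std_normal_density x *\<^sub>R iexp (s * x))"
    by (subst (asm) integrable_density) auto
  have "(LINT x|lborel. std_normal_density x *\<^sub>R iexp (s * x)) = char std_normal_distribution s"
    unfolding char_def by (subst integral_density) auto
  also have "\<dots> = of_real (exp (- s\<^sup>2 / 2))" by (simp add: char_std_normal_distribution)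
  finally have "has_bochner_integral lborel (\<lambda>x. std_normal_density x *\<^sub>R iexp (s * x)) (of_real (exp (- s\<^sup>2 / 2)) :: complex)"
    using int by (simp add: has_bochner_integral_iff)
  then have "has_bochner_integral lborel (\<lambda>x. std_normal_density (0 + k * x) *\<^sub>R iexp (s * (0 + k * x)))
      ((of_real (exp (- s\<^sup>2 / 2)) :: complex) /\<^sub>R \<bar>k\<bar>)"
    using k by (subst (asm) lborel_has_bochner_integral_real_affine_iff[of k _ _ 0]) auto
  then have "has_bochner_integral lborel (\<lambda>x. complex_of_real (sqrt (2 * pi)) * 
        (std_normal_density (0 + k * x) *\<^sub>R iexp (s * (0 + k * x))))
      (complex_of_real (sqrt (2 * pi)) * ((of_real (exp (- s\<^sup>2 / 2)) :: complex) /\<^sub>R \<bar>k\<bar>))"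
    by (intro has_bochner_integral_mult_right) auto
  also have "(\<lambda>x. complex_of_real (sqrt (2 * pi)) * (std_normal_density (0 + k * x) *\<^sub>R iexp (s * (0 + k * x))))
      = (\<lambda>y. exp (of_real (- c * y\<^sup>2) + 2 * of_real pi * \<i> * of_real (u * y)))"
  proof
    fix y
    have "s * k = 2 * pi * u" using k by (simp add: s_def)
    have "complex_of_real (sqrt (2 * pi)) * (std_normal_density (0 + k * y) *\<^sub>R iexp (s * (0 + k * y)))
        = of_real (exp (- (k * y)\<^sup>2 / 2)) * exp (\<i> * of_real ((s * k) * y))"
      by (simp add: std_normal_density_def scaleR_conv_of_real mult.assoc)
    also have "\<dots> = exp (of_real (- c * y\<^sup>2)) * exp (2 * of_real pi * \<i> * of_real (u * y))"
      using k \<open>s * k = _\<close> by (simp add: power_mult_distrib mult_ac flip: exp_of_real)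
    finally show "complex_of_real (sqrt (2 * pi)) * (std_normal_density (0 + k * y) *\<^sub>R iexp (s * (0 + k * y)))
      = exp (of_real (- c * y\<^sup>2) + 2 * of_real pi * \<i> * of_real (u * y))"
      by (simp only: exp_add)
  qed
  also have "complex_of_real (sqrt (2 * pi)) * ((of_real (exp (- s\<^sup>2 / 2)) :: complex) /\<^sub>R \<bar>k\<bar>)
      = complex_of_real (sqrt (pi / c) * exp (- (pi\<^sup>2 / c) * u\<^sup>2))"
  proof -
    have "sqrt (2 * pi) / k = sqrt (pi / c)"
      unfolding k_def by (simp add: real_sqrt_divide[symmetric])
    moreover have "s\<^sup>2 / 2 = (pi\<^sup>2 / c) * u\<^sup>2"
      using k c unfolding s_def power_divide by (simp add: power_mult_distrib)
    ultimately have "sqrt (2 * pi) * (exp (- s\<^sup>2 / 2) / k) = sqrt (pi / c) * exp (- (pi\<^sup>2 / c) * u\<^sup>2)"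
      by (metis minus_divide_left minus_mult_left times_divide_eq_left times_divide_eq_right)
    then show ?thesis using k
      by (simp add: scaleR_conv_of_real field_simps flip: of_real_mult of_real_divide)
  qed
  finally show ?thesis .
qed

text \<open>Fubini for products of functions of the single coordinates, which reduces the Fourier transform of a
  Gaussian to dimension one.\<close>

lemma integral_lborel_prod:
  fixes f :: "'a::euclidean_space \<Rightarrow> real \<Rightarrow> complex"
  assumes "\<And>b. b \<in> Basis \<Longrightarrow> has_bochner_integral lborel (f b) (I b)"
  shows "(LINT x|lborel. (\<Prod>b\<in>Basis. f b (x \<bullet> b))) = (\<Prod>b\<in>Basis. I b)"
proof -
  have [measurable]: "f b \<in> borel_measurable borel" if "b \<in> Basis" for b
    using assms[OF that] by (auto simp: has_bochner_integral_iff dest: borel_measurable_integrable)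
  interpret product_sigma_finite "\<lambda>b::'a. lborel :: real measure" ..
  have "(LINT x|lborel. (\<Prod>b\<in>Basis. f b (x \<bullet> b)))
      = (LINT x|(\<Pi>\<^sub>M b\<in>(Basis::'a set). lborel). (\<Prod>b\<in>Basis. f b ((\<Sum>b\<in>Basis. x b *\<^sub>R b) \<bullet> b)))"
    by (subst lborel_eq, subst integral_distr) auto
  also have "\<dots> = (LINT x|(\<Pi>\<^sub>M b\<in>(Basis::'a set). lborel). (\<Prod>b\<in>Basis. f b (x b)))"
    by (intro Bochner_Integration.integral_cong refl prod.cong) simp
  also have "\<dots> = (\<Prod>b\<in>Basis. LINT x|lborel. f b x)"
    using assms by (intro product_integral_prod) (auto simp: has_bochner_integral_iff)
  also have "\<dots> = (\<Prod>b\<in>Basis. I b)"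
    using assms by (intro prod.cong) (auto simp: has_bochner_integral_iff)
  finally show ?thesis .
qed

lemma fourier_modulated_gaussian:
  fixes t x :: "real^'d::finite"
  assumes c: "c > 0"
  shows "fourier (modulated_gaussian c t) x
    = of_real (sqrt (pi / c) ^ CARD('d) * exp (- (pi\<^sup>2 / c) * (norm (x - t))\<^sup>2))"
proof -
  define f where "f b y = exp (of_real (- c * y\<^sup>2) + 2 * of_real pi * \<i> * of_real (((t - x) \<bullet> b) * y))"
    for b :: "real^'d" and y :: real
  have "modulated_gaussian c t y * exp (- 2 * of_real pi * \<i> * of_real (y \<bullet> x)) = (\<Prod>b\<in>Basis. f b (y \<bullet> b))" for y
  proof -
    have "modulated_gaussian c t y * exp (- 2 * of_real pi * \<i> * of_real (y \<bullet> x))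
        = exp (of_real (- c * (y \<bullet> y)) + 2 * of_real pi * \<i> * of_real ((t - x) \<bullet> y))"
      unfolding modulated_gaussian_def
      by (simp add: algebra_simps inner_commute inner_diff_left flip: exp_add)
    also have "\<dots> = exp (\<Sum>b\<in>Basis. of_real (- c * (y \<bullet> b)\<^sup>2) + 2 * of_real pi * \<i> * of_real (((t - x) \<bullet> b) * (y \<bullet> b)))"
      unfolding sum.distrib sum_distrib_left[symmetric] of_real_sum[symmetric]
        euclidean_inner[of y y] euclidean_inner[of "t - x" y] power2_eq_square ..
    also have "\<dots> = (\<Prod>b\<in>Basis. f b (y \<bullet> b))"
      unfolding f_def by (rule exp_sum) simp
    finally show ?thesis .
  qed
  then have "fourier (modulated_gaussian c t) x = (LINT y|lborel. (\<Prod>b\<in>Basis. f b (y \<bullet> b)))"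
    unfolding fourier_def by simp
  also have "\<dots> = (\<Prod>b\<in>Basis. of_real (sqrt (pi / c) * exp (- (pi\<^sup>2 / c) * ((t - x) \<bullet> b)\<^sup>2)))"
    by (rule integral_lborel_prod) (use gaussian_fourier_real[OF c] in \<open>auto simp: f_def\<close>)
  also have "\<dots> = of_real (sqrt (pi / c) ^ CARD('d) * exp (\<Sum>b\<in>Basis. - (pi\<^sup>2 / c) * ((t - x) \<bullet> b)\<^sup>2))"
    by (subst exp_sum) (simp_all add: prod.distrib)
  also have "(\<Sum>b\<in>Basis. - (pi\<^sup>2 / c) * ((t - x) \<bullet> b)\<^sup>2) = - (pi\<^sup>2 / c) * (norm (x - t))\<^sup>2"
    unfolding sum_distrib_left[symmetric] norm_minus_commute[of x t]
      power2_norm_eq_inner euclidean_inner[of "t - x" "t - x"] power2_eq_square[of "_ \<bullet> _"] ..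
  finally show ?thesis .
qed

section \<open>Gaussian averages of a quasicrystal\<close>

text \<open>The growth condition is asymptotic and concerns infinite sums; the form needed for summation over
  shells is a bound for finite parts that holds from radius \<open>1\<close> on. Small radii are covered by
  enlarging them by the factor \<open>R\<close>, which carries each of these radii above the threshold \<open>r0\<close>.\<close>

lemma slowly_increasing_atomic_shells:
  assumes "slowly_increasing_atomic S b"
  shows "\<exists>C\<ge>0. \<exists>N. \<forall>(n::nat) A. finite A \<longrightarrow> A \<subseteq> S \<inter> ball 0 (real n + 1) \<longrightarrow>
    (\<Sum>x\<in>A. cmod (b x)) \<le> C * (real n + 1) ^ N"
proof -
  let ?V = "\<lambda>r. \<Sum>\<^sub>\<infinity>x\<in>S \<inter> ball 0 r. cmod (b x)"
  have sm: "(\<lambda>x. cmod (b x)) summable_on S \<inter> ball 0 r" for r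
    using assms by (simp add: slowly_increasing_atomic_def)
  obtain N where "?V \<in> O[at_top](\<lambda>r. r ^ N)"
    using assms unfolding slowly_increasing_atomic_def by blast
  then obtain c where c: "c > 0" "eventually (\<lambda>r. norm (?V r) \<le> c * norm (r ^ N)) at_top"
    by (elim landau_o.bigE)
  then obtain r0 where r0: "\<And>r. r \<ge> r0 \<Longrightarrow> norm (?V r) \<le> c * norm (r ^ N)"
    by (auto simp: eventually_at_top_linorder)
  define R where "R = \<bar>r0\<bar> + 1"
  show ?thesis
  proof (intro exI[of _ "c * R ^ N"] exI[of _ N] conjI allI impI)
    show "c * R ^ N \<ge> 0" using c unfolding R_def by simp
    fix n :: nat and A assume A: "finite A" "A \<subseteq> S \<inter> ball 0 (real n + 1)"
    have R: "r0 \<le> R * (real n + 1)" "real n + 1 \<le> R * (real n + 1)" "R \<ge> 0"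
    proof -
      have "R * 1 \<le> R * (real n + 1)" unfolding R_def by (intro mult_left_mono) auto
      moreover have "r0 \<le> R * 1" unfolding R_def by simp
      ultimately show "r0 \<le> R * (real n + 1)" by linarith
      have "1 * (real n + 1) \<le> R * (real n + 1)" unfolding R_def by (intro mult_right_mono) auto
      then show "real n + 1 \<le> R * (real n + 1)" by simp
    qed (simp add: R_def)
    have "ball 0 (real n + 1) \<subseteq> ball (0::real^'a) (R * (real n + 1))" by (rule subset_ball[OF R(2)])
    then have "A \<subseteq> S \<inter> ball 0 (R * (real n + 1))" using A(2) by blast
    then have "(\<Sum>x\<in>A. cmod (b x)) \<le> ?V (R * (real n + 1))"
      by (intro finite_sum_le_infsum sm A) auto
    also have "\<dots> \<le> c * norm ((R * (real n + 1)) ^ N)"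
      using r0[OF R(1)] by simp
    also have "\<dots> = c * R ^ N * (real n + 1) ^ N"
      using R(3) by (simp add: power_mult_distrib abs_mult power_abs)
    finally show "(\<Sum>x\<in>A. cmod (b x)) \<le> c * R ^ N * (real n + 1) ^ N" .
  qed
qed

lemma slowly_increasing_atomic_pointwise:
  assumes "slowly_increasing_atomic S b"
  shows "\<exists>C\<ge>0. \<exists>N. \<forall>x\<in>S. cmod (b x) \<le> C * (1 + norm x) ^ N"
proof -
  obtain C N where C: "C \<ge> 0" and "\<forall>(n::nat) A. finite A \<longrightarrow> A \<subseteq> S \<inter> ball 0 (real n + 1) \<longrightarrow>
    (\<Sum>x\<in>A. cmod (b x)) \<le> C * (real n + 1) ^ N"
    using slowly_increasing_atomic_shells[OF assms] by blast
  note shells = this(2)[rule_format]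
  have "cmod (b x) \<le> C * (1 + norm x) ^ N" if "x \<in> S" for x
  proof -
    define n where "n = nat \<lfloor>norm x\<rfloor>"
    have n: "real n \<le> norm x" "norm x < real n + 1" unfolding n_def by (simp_all add: of_nat_nat)
    have "cmod (b x) \<le> C * (real n + 1) ^ N" using shells[of "{x}" n] n that by simp
    also have "\<dots> \<le> C * (1 + norm x) ^ N" using C n by (intro mult_left_mono power_mono) auto
    finally show ?thesis .
  qed
  then show ?thesis using C by blast
qed

text \<open>The translation by \<open>t\<close> is absorbed by halving the exponent, as \<open>|x|\<^sup>2 \<le> 2 |x - t|\<^sup>2 + 2 |t|\<^sup>2\<close>.\<close>

lemma summable_slowly_increasing_gaussian:
  assumes b: "slowly_increasing_atomic S b" and q: "q > 0"
  shows "(\<lambda>x. cmod (b x) * exp (- q * (norm (x - t))\<^sup>2)) summable_on S"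
proof -
  obtain C N where C: "C \<ge> 0" and "\<forall>(n::nat) A. finite A \<longrightarrow> A \<subseteq> S \<inter> ball 0 (real n + 1) \<longrightarrow>
    (\<Sum>x\<in>A. cmod (b x)) \<le> C * (real n + 1) ^ N"
    using slowly_increasing_atomic_shells[OF b] by blast
  note shells = this(2)[rule_format]
  obtain B where B: "B > 0" "\<forall>r\<ge>0. (1 + r) ^ (N + 2) * exp (- (q / 2) * r\<^sup>2) \<le> B"
    using gaussian_decay[OF half_gt_zero[OF q], where M = "N + 2"] by blast
  define K where "K = exp (q * (norm t)\<^sup>2) * B"
  have K: "K \<ge> 0" using B by (simp add: K_def)
  have le: "exp (- q * (norm (x - t))\<^sup>2) \<le> K / (1 + norm x) ^ (N + 2)" for x
  proof -
    have "norm x \<le> norm (x - t) + norm t" using norm_triangle_sub[of x t] by (simp add: add.commute)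
    then have "(norm x)\<^sup>2 \<le> (norm (x - t) + norm t)\<^sup>2" by (intro power_mono) auto
    also have "\<dots> \<le> 2 * (norm (x - t))\<^sup>2 + 2 * (norm t)\<^sup>2"
      using zero_le_power2[of "norm (x - t) - norm t"] by (simp add: power2_eq_square algebra_simps)
    finally have "q * (norm x)\<^sup>2 \<le> q * (2 * (norm (x - t))\<^sup>2 + 2 * (norm t)\<^sup>2)"
      using q by (intro mult_left_mono) auto
    then have "exp (- q * (norm (x - t))\<^sup>2) \<le> exp (q * (norm t)\<^sup>2 + - (q / 2) * (norm x)\<^sup>2)"
      by (simp add: algebra_simps)
    also have "\<dots> = exp (q * (norm t)\<^sup>2) * exp (- (q / 2) * (norm x)\<^sup>2)"
      by (rule exp_add)
    also have "\<dots> \<le> exp (q * (norm t)\<^sup>2) * (B / (1 + norm x) ^ (N + 2))"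
      using B(2)[rule_format, of "norm x"] by (intro mult_left_mono) (auto simp: pos_le_divide_eq add_pos_nonneg mult.commute)
    finally show ?thesis by (simp add: K_def)
  qed
  show ?thesis
  proof (rule nonneg_bdd_above_summable_on)
    show "bdd_above (sum (\<lambda>x. cmod (b x) * exp (- q * (norm (x - t))\<^sup>2)) ` {F. F \<subseteq> S \<and> finite F})"
    proof (rule bdd_aboveI2)
      fix A assume "A \<in> {F. F \<subseteq> S \<and> finite F}"
      then have A: "A \<subseteq> S" "finite A" by auto
      have "(\<Sum>x\<in>A. cmod (b x) * exp (- q * (norm (x - t))\<^sup>2))
          \<le> (\<Sum>x\<in>A. cmod (b x) * (K / (1 + norm x) ^ (N + 2)))"
        by (intro sum_mono mult_left_mono le) auto
      also have "\<dots> = K * (\<Sum>x\<in>A. cmod (b x) / (1 + dist x 0) ^ (N + 2))"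
        by (simp add: sum_distrib_left mult_ac)
      also have "\<dots> \<le> K * (C * (\<Sum>n. 1 / (real n + 1)\<^sup>2))"
        using A K by (intro mult_left_mono sum_shells_le shells) auto
      finally show "(\<Sum>x\<in>A. cmod (b x) * exp (- q * (norm (x - t))\<^sup>2)) \<le> K * (C * (\<Sum>n. 1 / (real n + 1)\<^sup>2))" .
    qed
  qed simp
qed

definition gaussian_average :: "(real^'d::finite) set \<Rightarrow> (real^'d \<Rightarrow> complex) \<Rightarrow> real \<Rightarrow> real^'d \<Rightarrow> complex"
  where "gaussian_average \<Lambda> a q t = (\<Sum>\<^sub>\<infinity>x\<in>\<Lambda>. a x * exp (- q * (norm (x - t))\<^sup>2))"

text \<open>The defining identity of the quasicrystal, tested on \<open>modulated_gaussian p t\<close> with \<open>p = pi\<^sup>2 / q\<close>: the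
  left-hand side is a multiple of the Gaussian average at \<open>t\<close>, and on the right-hand side \<open>t\<close> occurs
  only in the characters. The coefficients are summable because the spectrum grows slowly while the
  Gaussian factor decays.\<close>

lemma gaussian_average_eq_character_sum:
  fixes \<Lambda> :: "(real^'d::finite) set"
  assumes "fourier_quasicrystal \<Lambda> a" and q: "q > 0"
  shows "\<exists>\<Gamma> c. (\<lambda>\<gamma>. norm (c \<gamma>)) summable_on \<Gamma> \<and>
    (\<forall>t. gaussian_average \<Lambda> a q t = (\<Sum>\<^sub>\<infinity>\<gamma>\<in>\<Gamma>. c \<gamma> * character \<gamma> t))"
proof -
  obtain \<Gamma> b where b: "slowly_increasing_atomic \<Gamma> b"
    and eq: "eq_dist (fourier_dist (delta_sum \<Lambda> a)) (delta_sum \<Gamma> b)"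
    using assms(1) unfolding fourier_quasicrystal_def by blast
  define p where "p = pi\<^sup>2 / q"
  have p: "p > 0" "pi\<^sup>2 / p = q" using q by (auto simp: p_def)
  define K where "K = complex_of_real (sqrt (pi / p) ^ CARD('d))"
  have K: "K \<noteq> 0" using p by (simp add: K_def)
  define c where "c \<gamma> = b \<gamma> * exp (- p * (norm \<gamma>)\<^sup>2) / K" for \<gamma>
  have "(\<lambda>\<gamma>. cmod (b \<gamma>) * exp (- p * (norm (\<gamma> - 0))\<^sup>2) * (1 / cmod K)) summable_on \<Gamma>"
    by (intro summable_on_cmult_left summable_slowly_increasing_gaussian b p)
  then have "(\<lambda>\<gamma>. norm (c \<gamma>)) summable_on \<Gamma>"
    by (simp add: c_def norm_mult norm_divide)
  moreover have "gaussian_average \<Lambda> a q t = (\<Sum>\<^sub>\<infinity>\<gamma>\<in>\<Gamma>. c \<gamma> * character \<gamma> t)" for t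
  proof -
    have "K * gaussian_average \<Lambda> a q t = (\<Sum>\<^sub>\<infinity>x\<in>\<Lambda>. K * (a x * exp (- q * (norm (x - t))\<^sup>2)))"
      unfolding gaussian_average_def by (rule infsum_cmult_right'[symmetric])
    also have "\<dots> = fourier_dist (delta_sum \<Lambda> a) (modulated_gaussian p t)"
      unfolding fourier_dist_def delta_sum_def fourier_modulated_gaussian[OF p(1)] p(2)
      by (simp add: K_def mult_ac)
    also have "\<dots> = delta_sum \<Gamma> b (modulated_gaussian p t)"
      using eq schwartz_modulated_gaussian[OF p(1)] unfolding eq_dist_def by blast
    also have "\<dots> = (\<Sum>\<^sub>\<infinity>\<gamma>\<in>\<Gamma>. K * (c \<gamma> * character \<gamma> t))"
      unfolding delta_sum_def
    proof (rule infsum_cong)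
      fix \<gamma>
      have "modulated_gaussian p t \<gamma> = of_real (exp (- p * (norm \<gamma>)\<^sup>2)) * character \<gamma> t"
        unfolding modulated_gaussian_def character_def exp_add dot_square_norm exp_of_real ..
      then show "b \<gamma> * modulated_gaussian p t \<gamma> = K * (c \<gamma> * character \<gamma> t)"
        using K by (simp add: c_def)
    qed
    also have "\<dots> = K * (\<Sum>\<^sub>\<infinity>\<gamma>\<in>\<Gamma>. c \<gamma> * character \<gamma> t)" by (rule infsum_cmult_right')
    finally show ?thesis using K by simp
  qed
  ultimately show ?thesis by blast
qed

lemma separated_shells:
  fixes A :: "'a::euclidean_space set"
  assumes fin: "finite A" and g: "g > 0"
    and sep: "\<And>x y. x \<in> A \<Longrightarrow> y \<in> A \<Longrightarrow> x \<noteq> y \<Longrightarrow> g \<le> dist x y"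
  shows "(\<Sum>x\<in>A. 1 / (1 + dist x t) ^ (DIM('a) + 2)) \<le> (1 + 2 / g) ^ DIM('a) * (\<Sum>n. 1 / (real n + 1)\<^sup>2)"
proof (rule sum_shells_le[OF fin])
  fix n :: nat
  have "(\<Sum>x\<in>A \<inter> ball t (real n + 1). 1) = real (card (A \<inter> ball t (real n + 1)))" by simp
  also have "\<dots> \<le> (1 + 2 * (real n + 1) / g) ^ DIM('a)"
    by (rule card_separated_le[of _ g _ t]) (use assms in auto)
  also have "\<dots> \<le> ((1 + 2 / g) * (real n + 1)) ^ DIM('a)"
    using g by (intro power_mono) (auto simp: field_simps)
  finally show "(\<Sum>x\<in>A \<inter> ball t (real n + 1). 1) \<le> (1 + 2 / g) ^ DIM('a) * (real n + 1) ^ DIM('a)"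
    by (simp add: power_mult_distrib)
qed simp

text \<open>Masses at distance at least \<open>\<eta>\<close> from \<open>t\<close> contribute little to a narrow Gaussian average at \<open>t\<close>. The
  masses may grow polynomially here, and \<open>q\<close> does not depend on \<open>P\<close> and \<open>Q\<close>: both matter for the
  bootstrap that shows the masses to be bounded.\<close>

lemma gaussian_tail:
  fixes \<Lambda> :: "(real^'d::finite) set" and a :: "real^'d \<Rightarrow> complex"
  assumes g: "g > 0" and sep: "\<forall>x\<in>\<Lambda>. \<forall>y\<in>\<Lambda>. x \<noteq> y \<longrightarrow> g \<le> dist x y"
    and \<eta>: "\<eta> > 0" and \<epsilon>: "\<epsilon> > 0"
  shows "\<exists>q>0. \<forall>P Q B t. P \<ge> 0 \<longrightarrow> Q \<ge> 0 \<longrightarrow> (\<forall>x\<in>\<Lambda>. cmod (a x) \<le> P + Q * (1 + norm x) ^ N) \<longrightarrow>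
      B \<subseteq> \<Lambda> \<longrightarrow> (\<forall>x\<in>B. \<eta> \<le> dist x t) \<longrightarrow>
      cmod (gaussian_average B a q t) \<le> \<epsilon> * (P + Q * (1 + norm t) ^ N)"
proof -
  let ?D = "CARD('d)"
  define W where "W = (1 + 2 / g) ^ ?D * (\<Sum>n. 1 / (real n + 1)\<^sup>2)"
  have "0 < (\<Sum>n. 1 / (real n + 1)\<^sup>2)"
    by (rule suminf_pos[OF summable_inverse_Suc_squares]) simp
  then have W: "W > 0" using g by (auto simp: W_def add_pos_pos intro!: mult_pos_pos zero_less_power)
  obtain q where q: "q > 0" "\<forall>r\<ge>\<eta>. exp (- q * r\<^sup>2) \<le> (\<epsilon> / W) / (1 + r) ^ (N + (?D + 2))"
    using gaussian_sharp[OF \<eta> divide_pos_pos[OF \<epsilon> W], where M = "N + (?D + 2)"] by blast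
  show ?thesis
  proof (intro exI[of _ q] conjI q(1) allI impI)
    fix P Q B t
    assume P: "P \<ge> 0" and Q: "Q \<ge> 0" and a: "\<forall>x\<in>\<Lambda>. cmod (a x) \<le> P + Q * (1 + norm x) ^ N"
      and B: "B \<subseteq> \<Lambda>" and far: "\<forall>x\<in>B. \<eta> \<le> dist x t"
    let ?f = "\<lambda>x. a x * exp (- q * (norm (x - t))\<^sup>2)"
    define Z where "Z = P + Q * (1 + norm t) ^ N"
    have Z: "Z \<ge> 0" using P Q by (simp add: Z_def)
    have le: "cmod (?f x) \<le> Z * (\<epsilon> / W) * (1 / (1 + dist x t) ^ (?D + 2))" if x: "x \<in> B" for x
    proof -
      have d: "1 + dist x t > 0" by (simp add: add_pos_nonneg)
      have "1 + norm x \<le> (1 + norm t) * (1 + dist x t)"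
      proof -
        have "0 \<le> norm t * dist x t" "norm x \<le> norm t + dist x t"
          using norm_triangle_sub[of x t] by (simp_all add: dist_norm)
        moreover have "(1 + norm t) * (1 + dist x t) = 1 + norm t + dist x t + norm t * dist x t"
          by (simp add: algebra_simps)
        ultimately show ?thesis by linarith
      qed
      then have "(1 + norm x) ^ N \<le> ((1 + norm t) * (1 + dist x t)) ^ N"
        by (intro power_mono) auto
      then have "P + Q * (1 + norm x) ^ N \<le> P * (1 + dist x t) ^ N + Q * ((1 + norm t) ^ N * (1 + dist x t) ^ N)"
        using P Q mult_left_mono[OF one_le_power[of "1 + dist x t" N] P]
        by (intro add_mono mult_left_mono) (auto simp: power_mult_distrib)
      then have ax: "cmod (a x) \<le> Z * (1 + dist x t) ^ N"
        using bspec[OF a, of x] x B unfolding Z_def by (auto simp: algebra_simps)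
      have "cmod (?f x) = cmod (a x) * exp (- q * (dist x t)\<^sup>2)"
        by (simp add: norm_mult dist_norm)
      also have "\<dots> \<le> (Z * (1 + dist x t) ^ N) * ((\<epsilon> / W) / (1 + dist x t) ^ (N + (?D + 2)))"
        using ax q(2)[rule_format, OF bspec[OF far x]] Z by (intro mult_mono) auto
      also have "\<dots> = Z * (\<epsilon> / W) * (1 / (1 + dist x t) ^ (?D + 2))"
        using d by (simp add: power_add)
      finally show ?thesis .
    qed
    have finite_le: "(\<Sum>x\<in>A. cmod (?f x)) \<le> \<epsilon> * Z" if A: "finite A" "A \<subseteq> B" for A
    proof -
      have "(\<Sum>x\<in>A. cmod (?f x)) \<le> (\<Sum>x\<in>A. Z * (\<epsilon> / W) * (1 / (1 + dist x t) ^ (?D + 2)))"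
        using le A by (intro sum_mono) blast
      also have "\<dots> = Z * (\<epsilon> / W) * (\<Sum>x\<in>A. 1 / (1 + dist x t) ^ (?D + 2))"
        by (rule sum_distrib_left[symmetric])
      also have "\<dots> \<le> Z * (\<epsilon> / W) * W"
      proof (rule mult_left_mono)
        show "(\<Sum>x\<in>A. 1 / (1 + dist x t) ^ (?D + 2)) \<le> W"
          using separated_shells[of A g t] A B g sep unfolding W_def by (simp add: subset_iff)
      qed (use Z \<epsilon> W in auto)
      also have "\<dots> = \<epsilon> * Z" using W by simp
      finally show ?thesis .
    qed
    have sm: "(\<lambda>x. cmod (?f x)) summable_on B"
      by (rule nonneg_bdd_above_summable_on, simp, rule bdd_aboveI2[of _ _ "\<epsilon> * Z"]) (use finite_le in blast)
    have "cmod (gaussian_average B a q t) \<le> (\<Sum>\<^sub>\<infinity>x\<in>B. cmod (?f x))"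
      unfolding gaussian_average_def by (rule norm_infsum_bound[OF sm])
    also have "\<dots> \<le> \<epsilon> * Z" by (rule infsum_le_finite_sums[OF sm finite_le])
    finally show "cmod (gaussian_average B a q t) \<le> \<epsilon> * (P + Q * (1 + norm t) ^ N)"
      by (simp add: Z_def)
  qed
qed

lemma gaussian_average_insert:
  assumes a: "slowly_increasing_atomic \<Lambda> a" and q: "q > 0" and z: "z \<in> \<Lambda>"
  shows "gaussian_average \<Lambda> a q z = a z + gaussian_average (\<Lambda> - {z}) a q z"
proof -
  let ?f = "\<lambda>x. a x * exp (- q * (norm (x - z))\<^sup>2)"
  have "(\<lambda>x. cmod (?f x)) summable_on \<Lambda>"
    using summable_slowly_increasing_gaussian[OF a q, of z] by (simp add: norm_mult)
  then have "?f summable_on \<Lambda>" by (rule abs_summable_summable)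
  then have sm: "?f summable_on X" if "X \<subseteq> \<Lambda>" for X
    using that by (rule summable_on_subset_banach)
  have "infsum ?f ({z} \<union> (\<Lambda> - {z})) = infsum ?f {z} + infsum ?f (\<Lambda> - {z})"
    using z by (intro infsum_Un_disjoint sm) auto
  moreover have "{z} \<union> (\<Lambda> - {z}) = \<Lambda>" using z by blast
  ultimately show ?thesis by (simp add: gaussian_average_def)
qed

text \<open>The masses are a priori of polynomial growth. Fix \<open>q\<close> such that the tail lemma holds with factor
  \<open>1 / 2\<close>, and let \<open>M\<close> bound the Gaussian average, which is a bounded function as a convergent sum of
  characters. The mass at \<open>x\<close> is the average at \<open>x\<close> minus the contribution of the other points, so a
  bound \<open>2 * M + E x\<close> on the masses, with \<open>E x\<close> a multiple of \<open>(1 + norm x) ^ N\<close>, improves itself to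
  \<open>M + (2 * M + E x) / 2 = 2 * M + E x / 2\<close>. Iteration removes the growing term.\<close>

lemma fourier_quasicrystal_bounded_masses:
  fixes \<Lambda> :: "(real^'d::finite) set"
  assumes fq: "fourier_quasicrystal \<Lambda> a"
    and g: "g > 0" and sep: "\<forall>x\<in>\<Lambda>. \<forall>y\<in>\<Lambda>. x \<noteq> y \<longrightarrow> g \<le> dist x y"
  shows "\<exists>A>0. \<forall>x\<in>\<Lambda>. cmod (a x) \<le> A"
proof -
  have sl: "slowly_increasing_atomic \<Lambda> a" using fq by (simp add: fourier_quasicrystal_def)
  obtain C N where C: "C \<ge> 0" "\<forall>x\<in>\<Lambda>. cmod (a x) \<le> C * (1 + norm x) ^ N"
    using slowly_increasing_atomic_pointwise[OF sl] by blast
  obtain q where q: "q > 0" and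
    "\<forall>P Q B t. P \<ge> 0 \<longrightarrow> Q \<ge> 0 \<longrightarrow> (\<forall>x\<in>\<Lambda>. cmod (a x) \<le> P + Q * (1 + norm x) ^ N) \<longrightarrow>
      B \<subseteq> \<Lambda> \<longrightarrow> (\<forall>x\<in>B. g \<le> dist x t) \<longrightarrow>
      cmod (gaussian_average B a q t) \<le> (1 / 2) * (P + Q * (1 + norm t) ^ N)"
    using gaussian_tail[OF g sep g half_gt_zero[OF zero_less_one], where N = N and a = a] by blast
  note tail = this(2)[rule_format]
  obtain \<Gamma> c where c: "(\<lambda>\<gamma>. norm (c \<gamma>)) summable_on \<Gamma>"
    "\<forall>t. gaussian_average \<Lambda> a q t = (\<Sum>\<^sub>\<infinity>\<gamma>\<in>\<Gamma>. c \<gamma> * character \<gamma> t)"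
    using gaussian_average_eq_character_sum[OF fq q] by blast
  define M where "M = (\<Sum>\<^sub>\<infinity>\<gamma>\<in>\<Gamma>. norm (c \<gamma>))"
  have "M \<ge> 0" unfolding M_def by (intro infsum_nonneg) auto
  have M: "cmod (gaussian_average \<Lambda> a q t) \<le> M" for t
    unfolding c(2)[rule_format] M_def by (rule norm_character_sum_le[OF c(1)])
  have step: "cmod (a x) \<le> 2 * M + (C / 2 ^ k) * (1 + norm x) ^ N" if "x \<in> \<Lambda>" for x k
    using that
  proof (induction k arbitrary: x)
    case 0
    then show ?case using C(2)[rule_format, of x] \<open>M \<ge> 0\<close> by simp
  next
    case (Suc k)
    have "a x = gaussian_average \<Lambda> a q x - gaussian_average (\<Lambda> - {x}) a q x"
      using gaussian_average_insert[OF sl q Suc.prems] by simp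
    then have "cmod (a x) \<le> cmod (gaussian_average \<Lambda> a q x) + cmod (gaussian_average (\<Lambda> - {x}) a q x)"
      using norm_triangle_ineq4 by metis
    also have "\<dots> \<le> M + (1 / 2) * (2 * M + (C / 2 ^ k) * (1 + norm x) ^ N)"
      by (intro add_mono M tail Suc.IH) (use \<open>M \<ge> 0\<close> C(1) sep Suc.prems in auto)
    also have "\<dots> = 2 * M + (1 / 2) * ((C / 2 ^ k) * (1 + norm x) ^ N)" by argo
    also have "(1 / 2) * ((C / 2 ^ k) * (1 + norm x) ^ N) = (C / 2 ^ Suc k) * (1 + norm x) ^ N" by simp
    finally show ?case .
  qed
  have "cmod (a x) \<le> 2 * M" if "x \<in> \<Lambda>" for x
  proof (rule LIMSEQ_le_const)
    have "(\<lambda>k. 2 * M + (C * (1 + norm x) ^ N) * (1 / 2) ^ k) \<longlonglongrightarrow> 2 * M + (C * (1 + norm x) ^ N) * 0"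
      by (intro tendsto_intros LIMSEQ_power_zero) auto
    then show "(\<lambda>k. 2 * M + (C * (1 + norm x) ^ N) * (1 / 2) ^ k) \<longlonglongrightarrow> 2 * M"
      by (simp only: mult_zero_right add_0_right)
    have "(C / 2 ^ k) * (1 + norm x) ^ N = (C * (1 + norm x) ^ N) * (1 / 2) ^ k" for k
      by (simp add: power_one_over)
    then show "\<exists>n. \<forall>k\<ge>n. cmod (a x) \<le> 2 * M + (C * (1 + norm x) ^ N) * (1 / 2) ^ k"
      using step[OF that] by (intro exI[of _ 0] allI impI) (simp only:)
  qed
  then have "\<forall>x\<in>\<Lambda>. cmod (a x) \<le> 2 * M + 1" by (simp add: add_increasing2)
  moreover have "2 * M + 1 > 0" using \<open>M \<ge> 0\<close> by simp
  ultimately show ?thesis by blast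
qed

text \<open>With all errors below a quarter of the least mass \<open>m\<close>: if \<open>s\<close> has no point of \<open>\<Lambda>\<close> within \<open>\<eta>\<close>, the
  average at \<open>s\<close> is at most \<open>m / 4\<close>, whereas at a point of \<open>\<Lambda>\<close> it is at least \<open>3 * m / 4\<close>. An
  \<open>m / 4\<close>-almost period of the average therefore cannot carry a point of \<open>\<Lambda>\<close> to such an \<open>s\<close>.\<close>

lemma relatively_dense_almost_translates:
  fixes \<Lambda> :: "(real^'d::finite) set"
  assumes fq: "fourier_quasicrystal \<Lambda> a"
    and g: "g > 0" and sep: "\<forall>x\<in>\<Lambda>. \<forall>y\<in>\<Lambda>. x \<noteq> y \<longrightarrow> g \<le> dist x y"
    and m: "m > 0" "\<And>x. x \<in> \<Lambda> \<Longrightarrow> m \<le> cmod (a x)"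
    and \<eta>: "\<eta> > 0"
  shows "relatively_dense (almost_translates \<Lambda> \<eta>)"
proof -
  have sl: "slowly_increasing_atomic \<Lambda> a" using fq by (simp add: fourier_quasicrystal_def)
  obtain A where A: "A > 0" "\<forall>x\<in>\<Lambda>. cmod (a x) \<le> A"
    using fourier_quasicrystal_bounded_masses[OF fq g sep] by blast
  define \<rho> where "\<rho> = min \<eta> g"
  have \<rho>: "\<rho> > 0" using \<eta> g by (simp add: \<rho>_def)
  have "m / (4 * A) > 0" using m A by simp
  obtain q where q: "q > 0" and tail0:
    "\<forall>P Q B t. P \<ge> 0 \<longrightarrow> Q \<ge> 0 \<longrightarrow> (\<forall>x\<in>\<Lambda>. cmod (a x) \<le> P + Q * (1 + norm x) ^ 0) \<longrightarrow>
      B \<subseteq> \<Lambda> \<longrightarrow> (\<forall>x\<in>B. \<rho> \<le> dist x t) \<longrightarrow>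
      cmod (gaussian_average B a q t) \<le> (m / (4 * A)) * (P + Q * (1 + norm t) ^ 0)"
    using gaussian_tail[OF g sep \<rho> \<open>m / (4 * A) > 0\<close>, where N = 0 and a = a] by blast
  have tail: "cmod (gaussian_average B a q t) \<le> m / 4"
    if "B \<subseteq> \<Lambda>" "\<And>x. x \<in> B \<Longrightarrow> \<rho> \<le> dist x t" for B t
    using tail0[rule_format, of A 0 B t] A that by simp
  let ?F = "gaussian_average \<Lambda> a q"
  obtain \<Gamma> c where c: "(\<lambda>\<gamma>. norm (c \<gamma>)) summable_on \<Gamma>"
    "\<forall>t. ?F t = (\<Sum>\<^sub>\<infinity>\<gamma>\<in>\<Gamma>. c \<gamma> * character \<gamma> t)"
    using gaussian_average_eq_character_sum[OF fq q] by blast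
  have near: "\<exists>y\<in>\<Lambda>. norm (y - s) < \<eta>" if x: "x \<in> \<Lambda>" and close: "cmod (?F s - ?F x) < m / 4" for x s
  proof (rule ccontr)
    assume "\<not> ?thesis"
    then have "cmod (?F s) \<le> m / 4" by (intro tail) (auto simp: \<rho>_def dist_norm not_less)
    moreover have "cmod (gaussian_average (\<Lambda> - {x}) a q x) \<le> m / 4"
      using sep x by (intro tail) (auto simp: \<rho>_def min_le_iff_disj)
    moreover have "a x = ?F s - (?F s - ?F x) - gaussian_average (\<Lambda> - {x}) a q x"
      using gaussian_average_insert[OF sl q x] by simp
    then have "cmod (a x) \<le> cmod (?F s - (?F s - ?F x)) + cmod (gaussian_average (\<Lambda> - {x}) a q x)"
      by (simp only: norm_triangle_ineq4)
    moreover have "cmod (?F s - (?F s - ?F x)) \<le> cmod (?F s) + cmod (?F s - ?F x)"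
      by (rule norm_triangle_ineq4)
    ultimately show False using m(2)[OF x] m(1) close by linarith
  qed
  have "{\<tau>. \<forall>t. cmod (?F (t + \<tau>) - ?F t) < m / 4} \<subseteq> almost_translates \<Lambda> \<eta>"
  proof
    fix \<tau> assume \<tau>: "\<tau> \<in> {\<tau>. \<forall>t. cmod (?F (t + \<tau>) - ?F t) < m / 4}"
    then have "cmod (?F (x + \<tau>) - ?F x) < m / 4" for x by blast
    moreover have "cmod (?F (x - \<tau> + \<tau>) - ?F (x - \<tau>)) < m / 4" for x using \<tau> by blast
    then have "cmod (?F (x - \<tau>) - ?F x) < m / 4" for x by (simp add: norm_minus_commute)
    ultimately show "\<tau> \<in> almost_translates \<Lambda> \<eta>"
      unfolding almost_translates_def using near by blast
  qed
  moreover have "relatively_dense {\<tau>. \<forall>t. cmod (?F (t + \<tau>) - ?F t) < m / 4}"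
    using m(1) by (intro relatively_dense_almost_periods[OF c(1) _ c(2)[rule_format]]) auto
  ultimately show ?thesis using relatively_dense_mono by blast
qed

theorem theorem2:
  fixes \<Lambda> :: "(real^'d::finite) set" and a :: "real^'d \<Rightarrow> complex"
  assumes "large_fourier_quasicrystal \<Lambda> a"
    and "discrete_set (difference_set \<Lambda>)"
  shows "\<exists>L F. full_rank_lattice L \<and> finite F \<and> \<Lambda> = (\<Union>v\<in>F. (+) v ` L)"
proof (cases "\<Lambda> = {}")
  case True
  have "full_rank_lattice (id ` {x::real^'d. \<forall>i. x $ i \<in> \<int>})"
    unfolding full_rank_lattice_def using linear_id bij_id by blast
  then show ?thesis unfolding True by (metis UN_empty finite.emptyI)
next
  case False
  have fq: "fourier_quasicrystal \<Lambda> a" and inf: "(INF x\<in>\<Lambda>. ereal (cmod (a x))) > 0"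
    using assms(1) by (auto simp: large_fourier_quasicrystal_def)
  obtain m where m: "0 < ereal m" "ereal m < (INF x\<in>\<Lambda>. ereal (cmod (a x)))"
    using ereal_dense2[OF inf] by blast
  have m_le: "m \<le> cmod (a x)" if "x \<in> \<Lambda>" for x
    using less_INF_D[OF m(2) that] by simp
  obtain g where g: "g > 0" "\<forall>x\<in>\<Lambda>. \<forall>y\<in>\<Lambda>. x \<noteq> y \<longrightarrow> g \<le> dist x y"
    using separated_of_discrete_differences[OF assms(2)] by blast
  have "relatively_dense (almost_translates \<Lambda> \<eta>)" if "\<eta> > 0" for \<eta>
    by (rule relatively_dense_almost_translates[OF fq g(1) g(2) _ m_le that]) (use m in auto)
  then have "relatively_dense (periods \<Lambda>)"
    by (rule relatively_dense_periods[OF assms(2) False])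
  then show ?thesis
    by (rule finite_union_of_lattice_translates[OF finite_Int_cball_of_difference_set[OF assms(2)]])
qed

end
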